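(* Let $b_1>1$ and $c>0$. In the sonic' surface $Son'\subset M\setminus\Pi$, the sonic' fold curve and the straight line $\{(t,z,Y): z=0,\ Y=-2c\}$ are the boundaries of the slow sonic' surface $Son'_s$ and the fast sonic' surface $Son'_f$.
   Context: Setting. Let $F=(f,g):\mathbb R^2\to\mathbb R^2$ with $f(u,v)=\frac{v^2}{2}+(b_1+1)\frac{u^2}{2}+a_1u+a_2v$ and $g(u,v)=uv+a_3u+a_4v$, where $a_1,\dots,a_4$ are real constants, $b_1>1$ and $c:=a_3-a_2>0$. For $W=(u,v)$, $W'=(u',v')$ put $U=\frac{u+u'}2$, $V=\frac{v+v'}2$, $X=u-u'$, $Y=v-v'$, $\tilde U=b_1U+a_1-a_4$, $\tilde V=V+a_2$, $V_1=V+a_3=\tilde V+c$. Wave manifold. $M$ is the 3-manifold obtained by blowing up $\{(W,W',s): F(W)-F(W')=s(W-W')\}$ along the diagonal $W=W'$: it is the set of $(U,V,X,Y)$ together with a direction $Z\in\mathbb{RP}^1$ such that $Y=ZX$ and $(1-Z^2)\tilde V-Z\tilde U+c=0$ (suitably homogenized at $Z=\infty$). $\Pi\subset M$ is the plane $Z=0$. On $M\setminus\Pi$ put $z=1/Z$, so $X=zY$ and the equation of $M$ becomes $(z^2-1)V_1-z\tilde U+c=0$. Global coordinates $(t,z,Y)\in\mathbb R^3$ on $M\setminus\Pi$ are given by $$\tilde U=\frac{2cz}{z^2+1}+ct(z^2-1),\qquad V_1=\frac{c}{z^2+1}+ctz .$$ The (shock) speed is the function $s$ on $M$ extending the common value of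 $s$ in $F(W)-F(W')=s(W-W')$; on $M\setminus\Pi$ it is $s=U+a_4+zV_1$. A Hugoniot curve is a set $\{u=\text{const},\,v=\text{const}\}$ in $M$, equivalently $2\tilde U+b_1X=k$, $2\tilde V+Y=l$ for constants $k,l$; $sh(\mathcal U)$ denotes the Hugoniot curve through $\mathcal U$. A Hugoniot' curve is a set $\{u'=\text{const},\,v'=\text{const}\}$. The characteristic surface is $\mathcal C=\{X=Y=0\}$. When $sh(\mathcal U)$ meets $\mathcal C$ in two distinct points, $\mathcal U_s$ denotes the one with the smaller value of $s$ and $\mathcal U_f$ the one with the larger value of $s$. The fold curve is the circle of points $p\in\mathcal C$ whose Hugoniot curve meets $\mathcal C$ only at $p$; on $M\setminus\Pi$ it is $\{Y=0,t=0\}$. The sonic' surface $Son'$ is the set of critical points of $s$ restricted to Hugoniot' curves; in coordinates $(t,z,Y)$ it is $$-2c\big((b_1+1)z^5+(b_1+4)z^3+3z\big)t+\big((b_1+1)z^4+b_1z^2-1\big)Y-2c\big((b_1-1)z^2+1\big)=0.$$ For $\mathcal U\in Son'$, the speed $s(\mathcal U)$ equals the speed at one of the points of $sh(\mathcal U)\cap\mathcal C$; the slow sonic' surface $Son'_s$ is the set of $\mathcal U\in Son'$ with $s(\mathcal U)=s(\mathcal U_s)$ and the fast sonic' surface $Son'_f$ is the set of $\mathcal U\in Son'$ with $s(\mathcal U)=s(\mathcal U_f)$. The sonic' fold curve is the curve along which $Son'$ is tangent to the surface $Tf$ formed by the Hugoniot curves through points of the fold curve (so Hugoniot curves are tangent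 to $Son'$ along it); it is parametrized by $z\in\mathbb R$ as $$t=-\frac{(b_1+2)z\big((b_1-1)z^2+1\big)}{(z^2+1)\big((b_1+1)^2z^4+2(b_1+3)z^2+1\big)},\qquad Y=-\frac{2c\big((b_1-1)z^2+1\big)}{(b_1+1)^2z^4+2(b_1+3)z^2+1}.$$
   Formalization: As topological boundary in Son', the claim fails for the line: its points with t≠0 are interior to Son'_s or Son'_f. Proved: the boundaries in Son' are the fold curve alone; fold and line together form the part of Son' over the boundaries of the two regions projected to the (z,Y)-plane. *)

theory Defs
  imports "HOL-Analysis.Analysis"
begin

section \<open>Curves and tangency\<close>

text \<open>Velocities at \<open>p\<close> of curves in \<open>S\<close>; for an embedded curve or surface this is the tangent space.\<close>

definition tangent_vectors :: "'a::real_normed_vector set \<Rightarrow> 'a \<Rightarrow> 'a set" where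
  "tangent_vectors S p =
     {w. \<exists>\<gamma>. \<gamma> 0 = p \<and> (\<forall>x::real. \<gamma> x \<in> S) \<and> (\<gamma> has_vector_derivative w) (at 0)}"

definition critical_on :: "('a::real_normed_vector \<Rightarrow> real) \<Rightarrow> 'a set \<Rightarrow> 'a \<Rightarrow> bool" where
  "critical_on h S p \<longleftrightarrow>
     p \<in> S \<and> (\<forall>w\<in>tangent_vectors S p. frechet_derivative h (at p) w = 0)"

section \<open>The wave manifold\<close>

record flux =
  a\<^sub>1 :: real
  a\<^sub>2 :: real
  a\<^sub>3 :: real
  a\<^sub>4 :: real
  b\<^sub>1 :: real

definition c_par :: "flux \<Rightarrow> real" where
  "c_par P = a\<^sub>3 P - a\<^sub>2 P"

definition flux_map :: "flux \<Rightarrow> real \<times> real \<Rightarrow> real \<times> real" where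
  "flux_map P = (\<lambda>(u, v).
     (v\<^sup>2 / 2 + (b\<^sub>1 P + 1) * u\<^sup>2 / 2 + a\<^sub>1 P * u + a\<^sub>2 P * v, u * v + a\<^sub>3 P * u + a\<^sub>4 P * v))"

text \<open>The projective line of directions \<open>Z\<close> is \<open>\<real> \<union> {\<infinity>}\<close> in the coordinate \<open>z = 1/Z\<close>:
  \<open>Fin z\<close> is \<open>Z = 1/z\<close> (so \<open>Fin 0\<close> is \<open>Z = \<infinity>\<close>), and \<open>Inf_dir\<close> is \<open>Z = 0\<close>.\<close>

datatype direction = Fin real | Inf_dir

datatype wpoint = WPoint (Upt: real) (Vpt: real) (Xpt: real) (Ypt: real) (dir: direction)

definition Utilde :: "flux \<Rightarrow> wpoint \<Rightarrow> real" where
  "Utilde P p = b\<^sub>1 P * Upt p + a\<^sub>1 P - a\<^sub>4 P"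

definition V1 :: "flux \<Rightarrow> wpoint \<Rightarrow> real" where
  "V1 P p = Vpt p + a\<^sub>3 P"

text \<open>At \<open>Z = 0\<close> the two equations \<open>Y = Z X\<close> and
  \<open>(1 - Z\<^sup>2) (V + a\<^sub>2) - Z Utilde + c = 0\<close> read \<open>Y = 0\<close> and \<open>V1 = 0\<close>;
  elsewhere they are multiplied by \<open>z\<close> and \<open>z\<^sup>2\<close>.\<close>

definition wave_manifold :: "flux \<Rightarrow> wpoint set" where
  "wave_manifold P = {p. case dir p of
       Fin z \<Rightarrow> Xpt p = z * Ypt p \<and> (z\<^sup>2 - 1) * V1 P p - z * Utilde P p + c_par P = 0
     | Inf_dir \<Rightarrow> Ypt p = 0 \<and> V1 P p = 0}"

definition left_state :: "wpoint \<Rightarrow> real \<times> real" where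
  "left_state p = (Upt p + Xpt p / 2, Vpt p + Ypt p / 2)"

definition right_state :: "wpoint \<Rightarrow> real \<times> real" where
  "right_state p = (Upt p - Xpt p / 2, Vpt p - Ypt p / 2)"

text \<open>On \<open>Z = 0\<close> the first Rankine--Hugoniot component gives
  \<open>s = (b\<^sub>1 + 1) U + a\<^sub>1 + Z (V + a\<^sub>2) = (b\<^sub>1 + 1) U + a\<^sub>1\<close>.\<close>

definition speed :: "flux \<Rightarrow> wpoint \<Rightarrow> real" where
  "speed P p = (case dir p of
       Fin z \<Rightarrow> Upt p + a\<^sub>4 P + z * V1 P p
     | Inf_dir \<Rightarrow> (b\<^sub>1 P + 1) * Upt p + a\<^sub>1 P)"

lemma rankine_hugoniot:
  assumes "p \<in> wave_manifold P"
  shows "flux_map P (left_state p) - flux_map P (right_state p)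
           = speed P p *\<^sub>R (left_state p - right_state p)"
proof (cases "dir p")
  case (Fin z)
  have X: "Xpt p = z * Ypt p"
    and E: "(z\<^sup>2 - 1) * V1 P p - z * Utilde P p + c_par P = 0"
    using assms Fin by (auto simp: wave_manifold_def)
  have "Ypt p * ((z\<^sup>2 - 1) * V1 P p - z * Utilde P p + c_par P) = 0"
    using E by simp
  then show ?thesis
    using Fin by (simp add: flux_map_def left_state_def right_state_def speed_def X V1_def
        Utilde_def c_par_def power2_eq_square field_simps)
next
  case Inf_dir
  then have "Ypt p = 0" "Vpt p = - a\<^sub>3 P"
    using assms by (auto simp: wave_manifold_def V1_def)
  then show ?thesis
    using Inf_dir by (simp add: flux_map_def left_state_def right_state_def speed_def
        power2_eq_square field_simps)
qed

definition hugoniot :: "flux \<Rightarrow> wpoint \<Rightarrow> wpoint set" where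
  "hugoniot P p = {q \<in> wave_manifold P. left_state q = left_state p}"

definition hugoniot' :: "flux \<Rightarrow> wpoint \<Rightarrow> wpoint set" where
  "hugoniot' P p = {q \<in> wave_manifold P. right_state q = right_state p}"

definition char_surface :: "flux \<Rightarrow> wpoint set" where
  "char_surface P = {p \<in> wave_manifold P. Xpt p = 0 \<and> Ypt p = 0}"

definition is_slow_point :: "flux \<Rightarrow> wpoint \<Rightarrow> wpoint \<Rightarrow> bool" where
  "is_slow_point P p q \<longleftrightarrow>
     (\<exists>r. hugoniot P p \<inter> char_surface P = {q, r} \<and> speed P q < speed P r)"

definition is_fast_point :: "flux \<Rightarrow> wpoint \<Rightarrow> wpoint \<Rightarrow> bool" where
  "is_fast_point P p q \<longleftrightarrow>
     (\<exists>r. hugoniot P p \<inter> char_surface P = {q, r} \<and> speed P r < speed P q)"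

definition fold_curve :: "flux \<Rightarrow> wpoint set" where
  "fold_curve P = {p \<in> char_surface P. hugoniot P p \<inter> char_surface P = {p}}"

section \<open>Coordinates off the plane Z = 0\<close>

type_synonym coords = "real \<times> real \<times> real"

definition chart :: "flux \<Rightarrow> coords \<Rightarrow> wpoint" where
  "chart P = (\<lambda>(t, z, Y).
     WPoint ((2 * c_par P * z / (z\<^sup>2 + 1) + c_par P * t * (z\<^sup>2 - 1) - a\<^sub>1 P + a\<^sub>4 P) / b\<^sub>1 P)
            (c_par P / (z\<^sup>2 + 1) + c_par P * t * z - a\<^sub>3 P)
            (z * Y) Y (Fin z))"

lemma chart_in_wave_manifold:
  assumes "b\<^sub>1 P \<noteq> 0"
  shows "chart P x \<in> wave_manifold P"
proof -
  obtain t z Y where x: "x = (t, z, Y)" by (cases x)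
  have "z\<^sup>2 + 1 \<noteq> 0" by (smt (verit) zero_le_power2)
  then show ?thesis
    using assms
    by (simp add: x chart_def wave_manifold_def V1_def Utilde_def divide_simps)
       (simp add: algebra_simps power2_eq_square)
qed

definition sonic' :: "flux \<Rightarrow> coords set" where
  "sonic' P = {x. critical_on (\<lambda>y. speed P (chart P y)) (chart P -` hugoniot' P (chart P x)) x}"

definition slow_sonic' :: "flux \<Rightarrow> coords set" where
  "slow_sonic' P = {x \<in> sonic' P.
     \<exists>q. is_slow_point P (chart P x) q \<and> speed P (chart P x) = speed P q}"

definition fast_sonic' :: "flux \<Rightarrow> coords set" where
  "fast_sonic' P = {x \<in> sonic' P.
     \<exists>q. is_fast_point P (chart P x) q \<and> speed P (chart P x) = speed P q}"

definition fold_surface :: "flux \<Rightarrow> coords set" where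
  "fold_surface P = chart P -` (\<Union>p\<in>fold_curve P. hugoniot P p)"

definition sonic'_fold :: "flux \<Rightarrow> coords set" where
  "sonic'_fold P = {x \<in> sonic' P \<inter> fold_surface P.
     tangent_vectors (sonic' P) x = tangent_vectors (fold_surface P) x}"

definition sonic'_line :: "flux \<Rightarrow> coords set" where
  "sonic'_line P = {(t, z, Y). z = 0 \<and> Y = - 2 * c_par P}"

text \<open>Off \<open>z = 0\<close> the equation of \<open>sonic'\<close> determines \<open>t\<close>, so \<open>(z, Y) = snd (t, z, Y)\<close> are
  coordinates there; the part in \<open>z = 0\<close> is \<open>sonic'_line\<close>, which \<open>snd\<close> collapses to a point.
  \<open>zY_boundary S A\<close> is the part of \<open>S\<close> over the boundary of the region of the \<open>(z, Y)\<close>-plane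
  occupied by \<open>A\<close>.\<close>

definition zY_boundary :: "coords set \<Rightarrow> coords set \<Rightarrow> coords set" where
  "zY_boundary S A = {x \<in> S. snd x \<in> frontier (snd ` A)}"

end

theory Submission
  imports Defs
begin

text \<open>On \<open>sonic'\<close> the shock speed \<open>s\<close> is one of the two characteristic speeds at the left state,
  so slow or fast is decided by the sign of the difference \<open>E\<close> between the other one and \<open>s\<close>.
  In coordinates \<open>E = (b + 2) z Y / 2 - c (z\<^sup>2 + 1) t\<close>. If \<open>N = 0\<close> is the equation of \<open>sonic'\<close>,
  the discriminant of the characteristic equation at the left state is
  \<open>E\<^sup>2 - Y N / (z\<^sup>2 + 1)\<close>. Hence \<open>sonic'\<close> meets \<open>fold_surface\<close> exactly where
  \<open>N = E = 0\<close>, and there the differentials of the two equations are proportional. For fixed \<open>z\<close>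
  both \<open>N\<close> and \<open>E\<close> are affine in \<open>(t, Y)\<close> and independent, so \<open>E\<close> changes sign across
  \<open>E = 0\<close> on \<open>sonic'\<close>. Finally \<open>z E\<close> is on \<open>sonic'\<close> a positive multiple of a function \<open>G\<close> of
  \<open>(z, Y)\<close>, so the projections of the two regions are \<open>z G > 0\<close> and \<open>z G < 0\<close> up to one point, with
  common frontier \<open>z G = 0\<close>.\<close>

section \<open>Level sets and frontiers\<close>

lemma has_vector_derivative_chain:
  fixes h :: "'a::real_normed_vector \<Rightarrow> 'b::real_normed_vector"
  assumes "(h has_derivative h') (at (\<gamma> x))" and "(\<gamma> has_vector_derivative w) (at x)"
  shows "((\<lambda>x. h (\<gamma> x)) has_vector_derivative h' w) (at x)"
proof -
  have "((\<lambda>x. h (\<gamma> x)) has_derivative (\<lambda>r. h' (r *\<^sub>R w))) (at x)"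
    using has_derivative_compose[OF assms(2)[unfolded has_vector_derivative_def] assms(1)] .
  then show ?thesis
    using has_derivative_linear[OF assms(1)] by (simp add: has_vector_derivative_def linear_cmul)
qed

text \<open>The curve follows the line \<open>p + x w\<close>, corrected along the transversal \<open>n\<close> by the zero of
  \<open>f\<close> closest to that line; the intermediate value theorem makes the correction \<open>o(x)\<close>, so no
  continuity of the derivative is needed.\<close>

lemma tangent_vectors_level_set:
  fixes f :: "'a::real_normed_vector \<Rightarrow> real"
  assumes cont: "continuous_on UNIV f" and der: "(f has_derivative f') (at p)"
    and "f p = 0" and "f' n \<noteq> 0"
  shows "tangent_vectors {x. f x = 0} p = {w. f' w = 0}"
proof (intro equalityI subsetI CollectI)
  fix w assume "w \<in> tangent_vectors {x. f x = 0} p"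
  then obtain \<gamma> where \<gamma>: "\<gamma> 0 = p" "\<And>x::real. f (\<gamma> x) = 0" "(\<gamma> has_vector_derivative w) (at 0)"
    by (auto simp: tangent_vectors_def)
  have "((\<lambda>x. f (\<gamma> x)) has_vector_derivative f' w) (at 0)"
    using has_vector_derivative_chain[of f f' \<gamma> 0 w] der \<gamma> by simp
  moreover have "((\<lambda>x. f (\<gamma> x)) has_vector_derivative 0) (at 0)"
    by (simp add: \<gamma>(2))
  ultimately show "f' w = 0"
    by (rule vector_derivative_unique_at)
next
  fix w assume "w \<in> {w. f' w = 0}"
  then have w: "f' w = 0" by simp
  have lin: "linear f'" using der by (rule has_derivative_linear)
  obtain m where m: "f' m > 0"
  proof (cases "f' n > 0")
    case False
    then have "f' (- n) > 0" using assms(4) linear_neg[OF lin, of n] by simp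
    then show thesis by (rule that)
  qed (rule that)
  define Z where "Z x = {y. f (p + x *\<^sub>R w + y *\<^sub>R m) = 0}" for x :: real
  have cont_line: "continuous_on S (\<lambda>y. f (p + x *\<^sub>R w + y *\<^sub>R m))" for x S
    by (rule continuous_on_compose2[OF cont]) (auto intro!: continuous_intros)
  have closed: "closed (Z x)" for x
    unfolding Z_def by (intro closed_Collect_eq cont_line continuous_on_const)
  have small: "\<exists>d>0. \<forall>x. \<bar>x\<bar> < d \<longrightarrow> (\<exists>y\<in>Z x. \<bar>y\<bar> \<le> e * \<bar>x\<bar>)" if "e > 0" for e
  proof -
    \<comment> \<open>A step with \<open>\<bar>y\<bar> = e * \<bar>x\<bar>\<close> has norm at most
      \<open>\<bar>x\<bar> * L\<close>. With \<open>e'\<close> the remainder is then at most the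
      linear term \<open>e * \<bar>x\<bar> * f' m\<close>, so \<open>f\<close> is nonpositive at one
      end and nonnegative at the other.\<close>
    define L where "L = norm w + e * norm m + 1"
    have L: "L > 0" using that by (simp add: L_def add_nonneg_pos)
    define e' where "e' = e * f' m / L"
    have e': "e' > 0" using that m L by (simp add: e'_def)
    obtain d where d: "d > 0"
      "\<And>h. norm (h - p) < d \<Longrightarrow> norm (f h - f p - f' (h - p)) \<le> e' * norm (h - p)"
      using der e' unfolding has_derivative_at_alt by blast
    show ?thesis
    proof (intro exI[of _ "d / L"] conjI allI impI)
      show "d / L > 0" using d L by simp
    next
      fix x :: real assume x: "\<bar>x\<bar> < d / L"
      have near: "\<bar>f (p + x *\<^sub>R w + y *\<^sub>R m) - y * f' m\<bar> \<le> e * \<bar>x\<bar> * f' m"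
        if y: "\<bar>y\<bar> = e * \<bar>x\<bar>" for y
      proof -
        let ?h = "x *\<^sub>R w + y *\<^sub>R m"
        have "norm ?h \<le> \<bar>x\<bar> * norm w + \<bar>y\<bar> * norm m"
          by (metis norm_scaleR norm_triangle_ineq)
        also have "\<dots> \<le> \<bar>x\<bar> * L"
          by (simp add: y L_def algebra_simps)
        finally have h: "norm ?h \<le> \<bar>x\<bar> * L" .
        also have "\<dots> < d" using x L by (simp add: field_simps)
        finally have "norm (f (p + ?h) - f p - f' ?h) \<le> e' * norm ?h"
          using d(2)[of "p + ?h"] by simp
        also have "\<dots> \<le> e' * (\<bar>x\<bar> * L)" using h e' by simp
        also have "\<dots> = e * \<bar>x\<bar> * f' m" using L by (simp add: e'_def)
        finally show ?thesis
          using assms(3) w by (simp add: linear_add[OF lin] linear_cmul[OF lin] add.assoc)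
      qed
      have "\<exists>y\<ge>- (e * \<bar>x\<bar>). y \<le> e * \<bar>x\<bar> \<and> f (p + x *\<^sub>R w + y *\<^sub>R m) = 0"
      proof (rule IVT')
        show "f (p + x *\<^sub>R w + (- (e * \<bar>x\<bar>)) *\<^sub>R m) \<le> 0"
          using near[of "- (e * \<bar>x\<bar>)"] \<open>e > 0\<close> by (simp add: abs_mult)
        show "0 \<le> f (p + x *\<^sub>R w + (e * \<bar>x\<bar>) *\<^sub>R m)"
          using near[of "e * \<bar>x\<bar>"] \<open>e > 0\<close> by (simp add: abs_mult)
        show "- (e * \<bar>x\<bar>) \<le> e * \<bar>x\<bar>" using \<open>e > 0\<close> by simp
      qed (rule cont_line)
      then show "\<exists>y\<in>Z x. \<bar>y\<bar> \<le> e * \<bar>x\<bar>"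
        by (auto simp: Z_def abs_le_iff)
    qed
  qed
  \<comment> \<open>One choice of \<open>y x\<close> must serve every \<open>e\<close>: the zero of
    least absolute value inherits each bound of \<open>small\<close>. It exists because
    \<open>Z x\<close> is closed.\<close>
  define y where "y x = (SOME y. y \<in> Z x \<and> (\<forall>y'\<in>Z x. \<bar>y\<bar> \<le> \<bar>y'\<bar>))" for x
  have closest: "y x \<in> Z x \<and> (\<forall>y'\<in>Z x. \<bar>y x\<bar> \<le> \<bar>y'\<bar>)" if nonempty: "Z x \<noteq> {}" for x
  proof -
    obtain y where "y \<in> Z x" "\<And>y'. y' \<in> Z x \<Longrightarrow> dist 0 y \<le> dist 0 y'"
      by (rule distance_attains_inf[OF closed nonempty, where a = 0]) blast
    then have "\<exists>y. y \<in> Z x \<and> (\<forall>y'\<in>Z x. \<bar>y\<bar> \<le> \<bar>y'\<bar>)"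
      by (intro exI[of _ y]) simp
    then show ?thesis unfolding y_def by (rule someI_ex)
  qed
  then have y: "\<And>x. Z x \<noteq> {} \<Longrightarrow> y x \<in> Z x"
    by simp
  have y_min: "\<bar>y x\<bar> \<le> \<bar>y'\<bar>" if "y' \<in> Z x" for x y'
    using closest[of x] that by (metis empty_iff)
  have "0 \<in> Z 0" using assms(3) by (simp add: Z_def)
  then have y0: "y 0 = 0" using y_min[of 0 0] by simp
  have "(y has_derivative (\<lambda>_. 0)) (at 0)"
    unfolding has_derivative_at_alt
  proof (intro conjI allI impI)
    fix e :: real assume "e > 0"
    then obtain d where "d > 0" "\<And>x. \<bar>x\<bar> < d \<Longrightarrow> \<exists>y\<in>Z x. \<bar>y\<bar> \<le> e * \<bar>x\<bar>"
      using small by blast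
    moreover have "\<bar>y x\<bar> \<le> e * \<bar>x\<bar>" if "\<exists>y\<in>Z x. \<bar>y\<bar> \<le> e * \<bar>x\<bar>" for x
      using that y_min order_trans by blast
    ultimately show "\<exists>d>0. \<forall>x. norm (x - 0) < d \<longrightarrow> norm (y x - y 0 - 0) \<le> e * norm (x - 0)"
      by (intro exI[of _ d]) (simp add: y0)
  qed simp
  then have "((\<lambda>x. p + x *\<^sub>R w + y x *\<^sub>R m) has_derivative
      (\<lambda>h. 0 + h *\<^sub>R w + 0 *\<^sub>R m)) (at 0)"
    by (intro has_derivative_add has_derivative_const has_derivative_scaleR_left has_derivative_ident)
  then have "((\<lambda>x. p + x *\<^sub>R w + y x *\<^sub>R m) has_vector_derivative w) (at 0)"
    by (simp add: has_vector_derivative_def)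
  moreover obtain d where d: "d > 0" "\<And>x. \<bar>x\<bar> < d \<Longrightarrow> Z x \<noteq> {}"
    using small[of 1] by (metis empty_iff zero_less_one)
  \<comment> \<open>The curve has to lie in the level set at every real parameter, so the value
    \<open>p\<close> is used where \<open>Z x\<close> is empty; near 0 this never happens.\<close>
  ultimately have "((\<lambda>x. if Z x = {} then p else p + x *\<^sub>R w + y x *\<^sub>R m)
      has_vector_derivative w) (at 0)"
    by (elim has_vector_derivative_transform_within[where d = d]) (simp_all add: d)
  moreover have "f (if Z x = {} then p else p + x *\<^sub>R w + y x *\<^sub>R m) = 0" for x
    using y[of x] assms(3) by (auto simp: Z_def)
  ultimately show "w \<in> tangent_vectors {x. f x = 0} p"
    unfolding tangent_vectors_def
    by (intro CollectI exI[of _ "\<lambda>x. if Z x = {} then p else p + x *\<^sub>R w + y x *\<^sub>R m"])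
      (simp add: y0)
qed

text \<open>The closed set \<open>h \<ge> 0\<close> contains the region and \<open>h \<le> 0\<close>
  its complement, so the two closures share only zeros of \<open>h\<close>; \<open>pos\<close> and
  \<open>neg\<close> put every zero in both. The set \<open>T\<close> allows for zeros that belong
  to the region.\<close>

lemma frontier_of_positive_region:
  fixes h :: "'a \<Rightarrow> real"
  assumes h: "continuous_map X euclideanreal h"
    and T: "T \<subseteq> {x \<in> topspace X. h x = 0}"
    and pos: "\<And>x. x \<in> topspace X \<Longrightarrow> h x = 0 \<Longrightarrow> x \<in> X closure_of {x \<in> topspace X. h x > 0}"
    and neg: "\<And>x. x \<in> topspace X \<Longrightarrow> h x = 0 \<Longrightarrow> x \<in> X closure_of {x \<in> topspace X. h x < 0}"
  shows "X frontier_of ({x \<in> topspace X. h x > 0} \<union> T) = {x \<in> topspace X. h x = 0}"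
    (is "X frontier_of ?S = ?Z")
proof -
  have "closedin X {x \<in> topspace X. h x \<in> {0..}}" "closedin X {x \<in> topspace X. h x \<in> {..0}}"
    by (rule closedin_continuous_map_preimage[OF h], simp)+
  moreover have "?S \<subseteq> {x \<in> topspace X. h x \<in> {0..}}"
    using T by auto
  moreover have "topspace X - ?S \<subseteq> {x \<in> topspace X. h x \<in> {..0}}"
    by auto
  ultimately have bounds: "X closure_of ?S \<subseteq> {x \<in> topspace X. h x \<in> {0..}}"
    "X closure_of (topspace X - ?S) \<subseteq> {x \<in> topspace X. h x \<in> {..0}}"
    by (simp_all add: closure_of_minimal)
  moreover have "?Z \<subseteq> X closure_of ?S"
  proof
    fix x assume "x \<in> ?Z"
    then show "x \<in> X closure_of ?S"
      using pos[of x] closure_of_mono[of "{x \<in> topspace X. h x > 0}" ?S X] by auto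
  qed
  moreover have "?Z \<subseteq> X closure_of (topspace X - ?S)"
  proof
    fix x assume "x \<in> ?Z"
    moreover have "{x \<in> topspace X. h x < 0} \<subseteq> topspace X - ?S" using T by auto
    ultimately show "x \<in> X closure_of (topspace X - ?S)"
      using neg[of x] closure_of_mono by blast
  qed
  ultimately have "X closure_of ?S \<inter> X closure_of (topspace X - ?S) = ?Z"
  proof (intro equalityI subsetI CollectI conjI)
    fix x assume x: "x \<in> X closure_of ?S \<inter> X closure_of (topspace X - ?S)"
    then have "x \<in> {x \<in> topspace X. h x \<in> {0..}}" "x \<in> {x \<in> topspace X. h x \<in> {..0}}"
      using bounds by blast+
    then show "x \<in> topspace X" "h x = 0" by auto
  qed blast
  then show ?thesis
    by (simp add: frontier_of_closures)
qed

lemma in_closure_at_right: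
  fixes \<gamma> :: "real \<Rightarrow> 'a::topological_space"
  assumes "isCont \<gamma> 0" and "\<gamma> 0 = p" and "eventually (\<lambda>x. \<gamma> x \<in> S) (at_right 0)"
  shows "p \<in> closure S"
proof (rule Lim_in_closed_set)
  show "(\<gamma> \<longlongrightarrow> p) (at_right 0)"
    using assms(1,2) tendsto_within_subset[of \<gamma> _ 0 UNIV "{0<..}"] by (simp add: isCont_def)
  show "eventually (\<lambda>x. \<gamma> x \<in> closure S) (at_right 0)"
    using assms(3) by eventually_elim (use closure_subset in blast)
qed auto

lemma eventually_at_right_pos:
  fixes G :: "real \<Rightarrow> real"
  assumes "isCont G a" and "G a > 0"
  shows "eventually (\<lambda>x. G x > 0) (at_right a)"
proof (rule order_tendstoD(1)[OF _ assms(2)])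
  show "(G \<longlongrightarrow> G a) (at_right a)"
    using assms(1) by (auto simp: isCont_def intro: tendsto_within_subset)
qed

section \<open>Polynomials in the coordinates\<close>

text \<open>The given equation of \<open>Son'\<close> with its coefficients factored: for
  \<open>b > 1\<close> and \<open>c > 0\<close> that of \<open>t\<close> vanishes only at
  \<open>z = 0\<close>.\<close>

definition sonic_poly :: "real \<Rightarrow> real \<Rightarrow> coords \<Rightarrow> real" where
  "sonic_poly b c = (\<lambda>(t, z, Y).
     - 2 * c * (z * (z\<^sup>2 + 1) * ((b + 1) * z\<^sup>2 + 3)) * t
       + ((b + 1) * z\<^sup>2 - 1) * (z\<^sup>2 + 1) * Y - 2 * c * ((b - 1) * z\<^sup>2 + 1))"

text \<open>The sum of the two characteristic speeds at the left state minus twice the shock speed. On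
  \<open>sonic'\<close> one of the two is the shock speed, so this is the other one minus the shock speed.\<close>

definition speed_gap :: "real \<Rightarrow> real \<Rightarrow> coords \<Rightarrow> real" where
  "speed_gap b c = (\<lambda>(t, z, Y). (b + 2) * z * Y / 2 - c * (z\<^sup>2 + 1) * t)"

definition fold_quartic :: "real \<Rightarrow> real \<Rightarrow> real" where
  "fold_quartic b z = (b + 1)\<^sup>2 * z ^ 4 + 2 * (b + 3) * z\<^sup>2 + 1"

text \<open>What is left of the gap on \<open>sonic'\<close> once \<open>t\<close> is eliminated, up
  to a factor in \<open>z\<close>. Its zero in \<open>Y\<close> is the given parametrization of the
  sonic' fold curve.\<close>

definition gap_numerator :: "real \<Rightarrow> real \<Rightarrow> real \<times> real \<Rightarrow> real" where
  "gap_numerator b c = (\<lambda>(z, Y). fold_quartic b z * Y + 2 * c * ((b - 1) * z\<^sup>2 + 1))"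

lemma square_plus_one_neq_0 [simp]: "z\<^sup>2 + 1 \<noteq> (0::real)"
  by (metis add_nonneg_eq_0_iff zero_le_power2 zero_le_one zero_neq_one)

lemma fold_quartic_pos: "b > 1 \<Longrightarrow> fold_quartic b z > 0"
  unfolding fold_quartic_def by (intro add_nonneg_pos add_nonneg_nonneg mult_nonneg_nonneg) auto

text \<open>Up to the factor \<open>- c * (z\<^sup>2 + 1)\<close> this is the determinant of the
  linear parts in \<open>(t, Y)\<close> of \<open>sonic_poly\<close> and \<open>speed_gap\<close> at
  fixed \<open>z\<close>; positivity gives their independence.\<close>

lemma fold_quartic_eq:
  "fold_quartic b z = (b + 2) * z\<^sup>2 * ((b + 1) * z\<^sup>2 + 3) - ((b + 1) * z\<^sup>2 - 1) * (z\<^sup>2 + 1)"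
  unfolding fold_quartic_def by algebra

text \<open>The factor on the left equalizes the coefficients of \<open>t\<close>, which therefore
  cancels against \<open>sonic_poly\<close>.\<close>

lemma gap_numerator_eq:
  "2 * z * ((b + 1) * z\<^sup>2 + 3) * speed_gap b c (t, z, Y)
     = sonic_poly b c (t, z, Y) + gap_numerator b c (z, Y)"
  by (simp add: sonic_poly_def speed_gap_def gap_numerator_def fold_quartic_eq algebra_simps
      power2_eq_square add_divide_distrib)

text \<open>\<open>A\<close> and \<open>B\<close> are \<open>Utilde\<close> and \<open>V1\<close> at
  the left state, with characteristic polynomial
  \<open>\<sigma>\<^sup>2 - A * \<sigma> + B * (c - B)\<close>. Its discriminant is
  \<open>(2 * \<sigma> - A)\<^sup>2\<close> minus four times its value at any
  \<open>\<sigma>\<close>; the shock speed, suitably shifted, is inserted for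
  \<open>\<sigma>\<close>.\<close>

lemma left_discriminant:
  fixes b c t z Y :: real
  defines "A \<equiv> 2 * c * z / (z\<^sup>2 + 1) + c * t * (z\<^sup>2 - 1) + b * (z * Y) / 2"
    and "B \<equiv> c / (z\<^sup>2 + 1) + c * t * z + Y / 2"
  shows "A\<^sup>2 - 4 * B * (c - B) = (speed_gap b c (t, z, Y))\<^sup>2 - Y / (z\<^sup>2 + 1) * sonic_poly b c (t, z, Y)"
proof -
  define k where "k = c / (z\<^sup>2 + 1)"
  have c: "c = k * (z\<^sup>2 + 1)" by (simp add: k_def)
  have A: "A = 2 * k * z + c * t * (z\<^sup>2 - 1) + b * (z * Y) / 2" and B: "B = k + c * t * z + Y / 2"
    by (simp_all add: A_def B_def k_def)
  have "Y / (z\<^sup>2 + 1) * sonic_poly b c (t, z, Y)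
      = Y * (- 2 * c * (z * ((b + 1) * z\<^sup>2 + 3)) * t + ((b + 1) * z\<^sup>2 - 1) * Y
          - 2 * k * ((b - 1) * z\<^sup>2 + 1))"
    by (simp add: sonic_poly_def k_def divide_simps) (simp add: algebra_simps)
  then show ?thesis
    unfolding A B speed_gap_def c by (simp add: power2_eq_square algebra_simps add_divide_distrib)
qed

text \<open>With speeds measured from \<open>u + a\<^sub>4 P\<close> at the left state,
  \<open>A\<close> is the sum of the characteristic speeds and \<open>z * (V - Y / 2)\<close> the
  shock speed.\<close>

lemma left_speed_gap:
  fixes b c t z Y :: real
  defines "A \<equiv> 2 * c * z / (z\<^sup>2 + 1) + c * t * (z\<^sup>2 - 1) + b * (z * Y) / 2"
    and "V \<equiv> c / (z\<^sup>2 + 1) + c * t * z"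
  shows "A - 2 * (z * (V - Y / 2)) = speed_gap b c (t, z, Y)"
  by (simp add: A_def V_def speed_gap_def field_simps power2_eq_square)

text \<open>Ensures that the factor of \<open>sonic_poly\<close> in \<open>left_discriminant\<close>
  is nonzero on the fold.\<close>

lemma sonic_fold_Y_neq_0:
  assumes "b > 1" "c > 0" "sonic_poly b c (t, z, Y) = 0" "speed_gap b c (t, z, Y) = 0"
  shows "Y \<noteq> 0"
proof
  assume "Y = 0"
  then have "2 * c * ((b - 1) * z\<^sup>2 + 1) = 0"
    using gap_numerator_eq[of z b c t Y] assms(3,4) by (simp add: gap_numerator_def)
  moreover have "(b - 1) * z\<^sup>2 + 1 > 0"
    using assms(1) by (intro add_nonneg_pos mult_nonneg_nonneg) auto
  ultimately show False using assms(2) by simp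
qed

text \<open>At fixed \<open>z\<close> the direction lies in the kernel of the linear part of
  \<open>sonic_poly\<close>, so the line stays in one level set.\<close>

lemma sonic_poly_line:
  "sonic_poly b c (t + x * (((b + 1) * z\<^sup>2 - 1) * (z\<^sup>2 + 1) * k), z,
       Y + x * (2 * c * (z * (z\<^sup>2 + 1) * ((b + 1) * z\<^sup>2 + 3)) * k))
     = sonic_poly b c (t, z, Y)"
  by (simp add: sonic_poly_def algebra_simps)

text \<open>The rate of change is the determinant from \<open>fold_quartic_eq\<close>.\<close>

lemma speed_gap_line:
  "speed_gap b c (t + x * (((b + 1) * z\<^sup>2 - 1) * (z\<^sup>2 + 1) * k), z,
       Y + x * (2 * c * (z * (z\<^sup>2 + 1) * ((b + 1) * z\<^sup>2 + 3)) * k))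
     = speed_gap b c (t, z, Y) + x * k * c * (z\<^sup>2 + 1) * fold_quartic b z"
  by (simp add: speed_gap_def fold_quartic_eq algebra_simps power2_eq_square add_divide_distrib)

lemma continuous_on_sonic_poly: "continuous_on S (sonic_poly b c)"
  unfolding sonic_poly_def case_prod_beta by (intro continuous_intros)

lemma continuous_on_speed_gap: "continuous_on S (speed_gap b c)"
  unfolding speed_gap_def case_prod_beta by (intro continuous_intros) auto

lemma differentiable_sonic_poly: "sonic_poly b c differentiable at x"
  unfolding sonic_poly_def case_prod_beta differentiable_def
  by (rule exI, (rule derivative_eq_intros refl)+)

lemma differentiable_speed_gap: "speed_gap b c differentiable at x"
  unfolding speed_gap_def case_prod_beta differentiable_def
  by (rule exI, (rule derivative_eq_intros refl | simp)+)

section \<open>Characteristic speeds at the left state\<close>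

lemma chart_simps:
  "Upt (chart P (t, z, Y))
     = (2 * c_par P * z / (z\<^sup>2 + 1) + c_par P * t * (z\<^sup>2 - 1) - a\<^sub>1 P + a\<^sub>4 P) / b\<^sub>1 P"
  "Vpt (chart P (t, z, Y)) = c_par P / (z\<^sup>2 + 1) + c_par P * t * z - a\<^sub>3 P"
  "Xpt (chart P (t, z, Y)) = z * Y"
  "Ypt (chart P (t, z, Y)) = Y"
  "dir (chart P (t, z, Y)) = Fin z"
  by (simp_all add: chart_def)

lemma Utilde_chart:
  "b\<^sub>1 P \<noteq> 0 \<Longrightarrow>
    Utilde P (chart P (t, z, Y)) = 2 * c_par P * z / (z\<^sup>2 + 1) + c_par P * t * (z\<^sup>2 - 1)"
  by (simp add: Utilde_def chart_simps)

lemma V1_chart: "V1 P (chart P (t, z, Y)) = c_par P / (z\<^sup>2 + 1) + c_par P * t * z"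
  by (simp add: V1_def chart_simps)

text \<open>In the chart \<open>2 * z * V1 - Utilde\<close> is
  \<open>c * t * (z\<^sup>2 + 1)\<close>, which recovers \<open>t\<close>; the manifold equation
  then restores \<open>Utilde\<close> and \<open>V1\<close>.\<close>

lemma chart_inverse:
  assumes "b\<^sub>1 P \<noteq> 0" and c: "c_par P \<noteq> 0" and p: "p \<in> wave_manifold P" and "dir p = Fin z"
  shows "chart P ((2 * z * V1 P p - Utilde P p) / (c_par P * (z\<^sup>2 + 1)), z, Ypt p) = p"
    (is "chart P (?t, _, _) = _")
proof -
  have X: "Xpt p = z * Ypt p" and E: "(z\<^sup>2 - 1) * V1 P p - z * Utilde P p + c_par P = 0"
    using p assms(4) by (auto simp: wave_manifold_def)
  have t: "c_par P * ?t * (z\<^sup>2 + 1) = 2 * z * V1 P p - Utilde P p"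
    using c by simp
  have "2 * c_par P * z / (z\<^sup>2 + 1) + c_par P * ?t * (z\<^sup>2 - 1) = Utilde P p"
  proof -
    have "2 * c_par P * z + c_par P * ?t * (z\<^sup>2 + 1) * (z\<^sup>2 - 1) = Utilde P p * (z\<^sup>2 + 1)"
      unfolding t using E by algebra
    then show ?thesis by (simp add: divide_simps mult_ac)
  qed
  moreover have "c_par P / (z\<^sup>2 + 1) + c_par P * ?t * z = V1 P p"
  proof -
    have "c_par P + c_par P * ?t * (z\<^sup>2 + 1) * z = V1 P p * (z\<^sup>2 + 1)"
      unfolding t using E by algebra
    then show ?thesis by (simp add: divide_simps mult_ac)
  qed
  ultimately show ?thesis
    using assms(1,4) X by (cases p) (simp add: chart_def Utilde_def V1_def)
qed

text \<open>Characteristic points over \<open>(u, v)\<close> are the directions with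
  \<open>(z\<^sup>2 - 1) * B - z * A + c = 0\<close>, and a finite one has shifted speed
  \<open>z * B\<close>. Multiplying by \<open>B\<close> gives a monic quadratic in the speed. For
  \<open>B = 0\<close> the direction \<open>Inf_dir\<close> supplies the root
  \<open>A\<close>.\<close>

lemma bij_betw_char_speed:
  assumes "c_par P \<noteq> 0" and "left_state p = (u, v)"
  defines "A \<equiv> b\<^sub>1 P * u + a\<^sub>1 P - a\<^sub>4 P" and "B \<equiv> v + a\<^sub>3 P"
  shows "bij_betw (\<lambda>q. speed P q - u - a\<^sub>4 P) (hugoniot P p \<inter> char_surface P)
    {\<sigma>. (2 * \<sigma> - A)\<^sup>2 = A\<^sup>2 - 4 * B * (c_par P - B)}"
proof -
  let ?S = "hugoniot P p \<inter> char_surface P"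
  let ?f = "\<lambda>q. speed P q - u - a\<^sub>4 P"
  define root where "root d \<longleftrightarrow> (case d of Fin z \<Rightarrow> (z\<^sup>2 - 1) * B - z * A + c_par P = 0 | Inf_dir \<Rightarrow> B = 0)" for d
  have S: "?S = (\<lambda>d. WPoint u v 0 0 d) ` {d. root d}"
  proof (intro equalityI subsetI)
    fix q assume "q \<in> ?S"
    then show "q \<in> (\<lambda>d. WPoint u v 0 0 d) ` {d. root d}"
      using assms(2) by (cases q) (auto simp: hugoniot_def char_surface_def wave_manifold_def
          left_state_def root_def A_def B_def Utilde_def V1_def split: direction.splits)
  next
    fix q assume "q \<in> (\<lambda>d. WPoint u v 0 0 d) ` {d. root d}"
    then show "q \<in> ?S"
      using assms(2) by (auto simp: hugoniot_def char_surface_def wave_manifold_def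
          left_state_def root_def A_def B_def Utilde_def V1_def split: direction.splits)
  qed
  define g where "g d = (case d of Fin z \<Rightarrow> z * B | Inf_dir \<Rightarrow> A)" for d
  have f: "?f (WPoint u v 0 0 d) = g d" for d
    by (simp add: speed_def g_def A_def B_def V1_def algebra_simps split: direction.splits)
  have "bij_betw g {d. root d} {\<sigma>. (2 * \<sigma> - A)\<^sup>2 = A\<^sup>2 - 4 * B * (c_par P - B)}"
  proof (cases "B = 0")
    case True
    \<comment> \<open>As \<open>c\<close> is nonzero, \<open>A = 0\<close> excludes a finite
      direction; then the roots \<open>A\<close> and \<open>0\<close> coincide and
      \<open>Inf_dir\<close> alone accounts for them.\<close>
    have g: "d = Inf_dir \<and> g d = A \<or> A \<noteq> 0 \<and> d = Fin (c_par P / A) \<and> g d = 0" if "root d" for d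
      using that True assms(1) by (auto simp: root_def g_def field_simps split: direction.splits)
    show ?thesis
    proof (intro bij_betwI')
      fix d d' assume "d \<in> {d. root d}" "d' \<in> {d. root d}"
      then show "(g d = g d') = (d = d')" using g[of d] g[of d'] by auto
    next
      fix d assume "d \<in> {d. root d}"
      then show "g d \<in> {\<sigma>. (2 * \<sigma> - A)\<^sup>2 = A\<^sup>2 - 4 * B * (c_par P - B)}"
        using g[of d] True by auto
    next
      fix \<sigma> assume "\<sigma> \<in> {\<sigma>. (2 * \<sigma> - A)\<^sup>2 = A\<^sup>2 - 4 * B * (c_par P - B)}"
      then have "\<sigma> = A \<or> \<sigma> = 0 \<and> A \<noteq> 0"
        using True by (auto simp: power2_eq_iff)
      then show "\<exists>d\<in>{d. root d}. \<sigma> = g d"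
      proof
        assume "\<sigma> = A"
        then show ?thesis using True by (intro bexI[of _ Inf_dir]) (auto simp: g_def root_def)
      next
        assume "\<sigma> = 0 \<and> A \<noteq> 0"
        then show ?thesis using True by (intro bexI[of _ "Fin (c_par P / A)"]) (auto simp: g_def root_def)
      qed
    qed
  next
    case False
    have g: "\<exists>z. d = Fin z \<and> g d = z * B" if "root d" for d
      using that False by (auto simp: root_def g_def split: direction.splits)
    have quadratic: "(2 * (z * B) - A)\<^sup>2 = A\<^sup>2 - 4 * B * (c_par P - B)
        \<longleftrightarrow> (z\<^sup>2 - 1) * B - z * A + c_par P = 0" for z
    proof -
      have "(2 * (z * B) - A)\<^sup>2 - (A\<^sup>2 - 4 * B * (c_par P - B))
          = 4 * B * ((z\<^sup>2 - 1) * B - z * A + c_par P)"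
        by (simp add: power2_eq_square algebra_simps)
      then show ?thesis using False by auto
    qed
    show ?thesis
    proof (intro bij_betwI')
      fix d d' assume "d \<in> {d. root d}" "d' \<in> {d. root d}"
      then obtain z z' where "d = Fin z" "g d = z * B" "d' = Fin z'" "g d' = z' * B"
        using g by blast
      then show "(g d = g d') = (d = d')" using False by simp
    next
      fix d assume d: "d \<in> {d. root d}"
      then obtain z where "d = Fin z" "g d = z * B" using g[of d] by auto
      then show "g d \<in> {\<sigma>. (2 * \<sigma> - A)\<^sup>2 = A\<^sup>2 - 4 * B * (c_par P - B)}"
        using d quadratic[of z] by (simp add: root_def)
    next
      fix \<sigma> assume "\<sigma> \<in> {\<sigma>. (2 * \<sigma> - A)\<^sup>2 = A\<^sup>2 - 4 * B * (c_par P - B)}"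
      then have "root (Fin (\<sigma> / B))"
        using quadratic[of "\<sigma> / B"] False by (simp add: root_def)
      then show "\<exists>d\<in>{d. root d}. \<sigma> = g d"
        using False by (intro bexI[of _ "Fin (\<sigma> / B)"]) (simp_all add: g_def)
    qed
  qed
  then have "bij_betw (?f \<circ> (\<lambda>d. WPoint u v 0 0 d)) {d. root d}
      {\<sigma>. (2 * \<sigma> - A)\<^sup>2 = A\<^sup>2 - 4 * B * (c_par P - B)}"
    by (simp add: comp_def f)
  moreover have "bij_betw (\<lambda>d. WPoint u v 0 0 d) {d. root d} ?S"
    unfolding S by (intro bij_betw_imageI inj_onI) auto
  ultimately show ?thesis
    using bij_betw_comp_iff by blast
qed

text \<open>By injectivity the values decide everything. For \<open>e = 0\<close> the set is a
  single point and both strict comparisons fail.\<close>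

lemma bij_betw_pair_less_iff:
  fixes f :: "'a \<Rightarrow> real"
  assumes "bij_betw f S {x, x + e}"
  shows "(\<exists>q r. S = {q, r} \<and> f q < f r \<and> f q = x) \<longleftrightarrow> e > 0"
    and "(\<exists>q r. S = {q, r} \<and> f r < f q \<and> f q = x) \<longleftrightarrow> e < 0"
proof -
  have image: "f ` S = {x, x + e}" and inj: "inj_on f S"
    using assms by (auto simp: bij_betw_def)
  have "x \<in> f ` S" "x + e \<in> f ` S" unfolding image by auto
  then obtain q r where qr: "q \<in> S" "f q = x" "r \<in> S" "f r = x + e" by (metis imageE)
  have S: "S = {q, r}"
  proof (intro equalityI subsetI)
    fix s assume s: "s \<in> S"
    then have "f s \<in> {x, x + e}" using image by blast
    then show "s \<in> {q, r}" using qr s inj by (auto simp: inj_on_def)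
  qed (use qr in auto)
  show "(\<exists>q r. S = {q, r} \<and> f q < f r \<and> f q = x) \<longleftrightarrow> e > 0"
  proof
    assume "\<exists>q r. S = {q, r} \<and> f q < f r \<and> f q = x"
    then obtain q' r' where q': "S = {q', r'}" "f q' < f r'" "f q' = x" by blast
    then have "f r' \<in> {x, x + e}" using image by blast
    then show "e > 0" using q' by auto
  next
    assume "e > 0"
    then show "\<exists>q r. S = {q, r} \<and> f q < f r \<and> f q = x"
      by (intro exI[of _ q] exI[of _ r]) (simp add: S qr)
  qed
  show "(\<exists>q r. S = {q, r} \<and> f r < f q \<and> f q = x) \<longleftrightarrow> e < 0"
  proof
    assume "\<exists>q r. S = {q, r} \<and> f r < f q \<and> f q = x"
    then obtain q' r' where q': "S = {q', r'}" "f r' < f q'" "f q' = x" by blast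
    then have "f r' \<in> {x, x + e}" using image by blast
    then show "e < 0" using q' by auto
  next
    assume "e < 0"
    then show "\<exists>q r. S = {q, r} \<and> f r < f q \<and> f q = x"
      by (intro exI[of _ q] exI[of _ r]) (simp add: S qr)
  qed
qed

text \<open>The roots are symmetric under \<open>\<sigma> \<mapsto> A - \<sigma>\<close>, so a lone
  root is \<open>A / 2\<close>. A negative \<open>D\<close> leaves \<open>S\<close> empty.\<close>

lemma singleton_iff_discriminant_0:
  fixes f :: "'a \<Rightarrow> real"
  assumes "bij_betw f S {\<sigma>. (2 * \<sigma> - A)\<^sup>2 = D}"
  shows "(\<exists>q. S = {q}) \<longleftrightarrow> D = 0"
proof
  assume "\<exists>q. S = {q}"
  then obtain q where "S = {q}" by blast
  then have roots: "{\<sigma>. (2 * \<sigma> - A)\<^sup>2 = D} = {f q}"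
    using assms by (simp add: bij_betw_def)
  then have "(2 * f q - A)\<^sup>2 = D" by auto
  moreover from this have "(2 * (A - f q) - A)\<^sup>2 = D"
    by (simp add: power2_eq_square algebra_simps)
  then have "A - f q = f q" using roots by blast
  ultimately show "D = 0" by (auto simp: power2_eq_square)
next
  assume "D = 0"
  then have image: "f ` S = {A / 2}" and "inj_on f S"
    using assms by (auto simp: bij_betw_def)
  moreover obtain q where "q \<in> S" using image by blast
  moreover have "f s = A / 2" if "s \<in> S" for s using image that by blast
  ultimately have "S = {q}" by (auto simp: inj_on_def)
  then show "\<exists>q. S = {q}" by blast
qed

text \<open>Shifting the speeds by \<open>\<sigma>\<close> changes the sum of the roots from
  \<open>A\<close> to the gap and keeps the discriminant.\<close>

lemma bij_betw_char_speed_chart: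
  assumes b: "b\<^sub>1 P \<noteq> 0" and c: "c_par P \<noteq> 0"
  shows "bij_betw (\<lambda>q. speed P q - speed P (chart P (t, z, Y)))
    (hugoniot P (chart P (t, z, Y)) \<inter> char_surface P)
    {\<delta>. (2 * \<delta> - speed_gap (b\<^sub>1 P) (c_par P) (t, z, Y))\<^sup>2
        = (speed_gap (b\<^sub>1 P) (c_par P) (t, z, Y))\<^sup>2
          - Y / (z\<^sup>2 + 1) * sonic_poly (b\<^sub>1 P) (c_par P) (t, z, Y)}"
    (is "bij_betw ?f ?S {\<delta>. (2 * \<delta> - ?E)\<^sup>2 = ?D}")
proof -
  let ?p = "chart P (t, z, Y)"
  define u where "u = Upt ?p + z * Y / 2"
  define v where "v = Vpt ?p + Y / 2"
  define A where "A = 2 * c_par P * z / (z\<^sup>2 + 1) + c_par P * t * (z\<^sup>2 - 1) + b\<^sub>1 P * (z * Y) / 2"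
  define B where "B = c_par P / (z\<^sup>2 + 1) + c_par P * t * z + Y / 2"
  define \<sigma> where "\<sigma> = speed P ?p - u - a\<^sub>4 P"
  have left: "left_state ?p = (u, v)"
    by (simp add: left_state_def u_def v_def chart_simps)
  have A: "b\<^sub>1 P * u + a\<^sub>1 P - a\<^sub>4 P = A"
    using Utilde_chart[OF b, of t z Y] by (simp add: u_def A_def Utilde_def algebra_simps)
  have B: "v + a\<^sub>3 P = B"
    by (simp add: v_def B_def chart_simps)
  have "\<sigma> = z * (B - Y)"
    by (simp add: \<sigma>_def u_def B_def speed_def chart_simps V1_def algebra_simps)
  then have E: "?E = A - 2 * \<sigma>"
    using left_speed_gap[where b = "b\<^sub>1 P" and c = "c_par P" and t = t and z = z and Y = Y]
    by (simp add: A_def B_def algebra_simps)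
  have D: "A\<^sup>2 - 4 * B * (c_par P - B) = ?D"
    unfolding A_def B_def by (rule left_discriminant)
  have "bij_betw (\<lambda>q. speed P q - u - a\<^sub>4 P) ?S {\<tau>. (2 * \<tau> - A)\<^sup>2 = ?D}"
    using bij_betw_char_speed[OF c left] unfolding A B D .
  moreover have "bij_betw (\<lambda>\<tau>. \<tau> - \<sigma>) {\<tau>. (2 * \<tau> - A)\<^sup>2 = ?D} {\<delta>. (2 * \<delta> - ?E)\<^sup>2 = ?D}"
    unfolding E by (rule bij_betw_byWitness[where f' = "\<lambda>\<delta>. \<delta> + \<sigma>"]) (auto simp: algebra_simps)
  ultimately have "bij_betw ((\<lambda>\<tau>. \<tau> - \<sigma>) \<circ> (\<lambda>q. speed P q - u - a\<^sub>4 P)) ?S {\<delta>. (2 * \<delta> - ?E)\<^sup>2 = ?D}"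
    by (rule bij_betw_trans)
  then show ?thesis
    by (simp add: comp_def \<sigma>_def)
qed

text \<open>On \<open>sonic'\<close> the discriminant is the square of the gap. The form
  \<open>0 + ...\<close> fits the pattern \<open>x + e\<close> of
  \<open>bij_betw_pair_less_iff\<close>.\<close>

lemma sonic_char_speeds:
  assumes "b\<^sub>1 P \<noteq> 0" and "c_par P \<noteq> 0" and N: "sonic_poly (b\<^sub>1 P) (c_par P) x = 0"
  shows "bij_betw (\<lambda>q. speed P q - speed P (chart P x)) (hugoniot P (chart P x) \<inter> char_surface P)
    {0, 0 + speed_gap (b\<^sub>1 P) (c_par P) x}"
proof -
  obtain t z Y where x: "x = (t, z, Y)" by (cases x)
  have "{\<delta>. (2 * \<delta> - e)\<^sup>2 = e\<^sup>2} = {0, 0 + e}" for e :: real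
    by (auto simp: power2_eq_iff)
  then show ?thesis
    using bij_betw_char_speed_chart[OF assms(1,2), of t z Y] N by (simp add: x)
qed

text \<open>Points with equal left states share their Hugoniot curve. So a point lies over the fold
  iff its own curve meets the characteristic surface once.\<close>

lemma fold_surface_eq:
  assumes b: "b\<^sub>1 P \<noteq> 0" and c: "c_par P \<noteq> 0"
  shows "fold_surface P = {x. (case x of (t, z, Y) \<Rightarrow>
    (speed_gap (b\<^sub>1 P) (c_par P) x)\<^sup>2 - Y / (z\<^sup>2 + 1) * sonic_poly (b\<^sub>1 P) (c_par P) x) = 0}"
proof -
  have "x \<in> fold_surface P \<longleftrightarrow> (\<exists>q. hugoniot P (chart P x) \<inter> char_surface P = {q})" for x
  proof
    assume "x \<in> fold_surface P"
    then obtain p where p: "hugoniot P p \<inter> char_surface P = {p}" "chart P x \<in> hugoniot P p"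
      by (auto simp: fold_surface_def fold_curve_def)
    then have "hugoniot P (chart P x) = hugoniot P p" by (simp add: hugoniot_def)
    then show "\<exists>q. hugoniot P (chart P x) \<inter> char_surface P = {q}" using p by auto
  next
    assume "\<exists>q. hugoniot P (chart P x) \<inter> char_surface P = {q}"
    then obtain q where q: "hugoniot P (chart P x) \<inter> char_surface P = {q}" ..
    then have q': "q \<in> char_surface P" "left_state q = left_state (chart P x)"
      by (auto simp: hugoniot_def)
    then have "hugoniot P q = hugoniot P (chart P x)" by (simp add: hugoniot_def)
    then have "q \<in> fold_curve P" using q q' by (simp add: fold_curve_def)
    moreover have "chart P x \<in> hugoniot P q"
      using q' chart_in_wave_manifold[OF b] by (simp add: hugoniot_def)
    ultimately show "x \<in> fold_surface P" by (auto simp: fold_surface_def)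
  qed
  then show ?thesis
    using singleton_iff_discriminant_0[OF bij_betw_char_speed_chart[OF b c]] by auto
qed

section \<open>The sonic' surface and its fold\<close>

lemma speed_chart_differentiable:
  assumes "b\<^sub>1 P \<noteq> 0"
  shows "(\<lambda>y. speed P (chart P y)) differentiable at x"
  unfolding speed_def chart_def V1_def case_prod_beta direction.case wpoint.sel differentiable_def
  by (rule exI, (rule derivative_eq_intros refl | simp add: assms)+)

text \<open>Along \<open>hugoniot'\<close> the direction \<open>z\<close> is a global parameter, as \<open>Y\<close> solves a linear equation
  with leading coefficient \<open>(b - 1) z\<^sup>2 + 1\<close>. So criticality of the speed is the vanishing of
  its derivative in \<open>z\<close>.\<close>

lemma sonic'_eq:
  assumes b: "b\<^sub>1 P > 1" and c: "c_par P \<noteq> 0"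
  shows "sonic' P = {x. sonic_poly (b\<^sub>1 P) (c_par P) x = 0}"
proof (rule set_eqI)
  fix x :: coords
  obtain t\<^sub>0 z\<^sub>0 Y\<^sub>0 where x: "x = (t\<^sub>0, z\<^sub>0, Y\<^sub>0)" by (cases x)
  let ?b = "b\<^sub>1 P" and ?c = "c_par P"
  have b0: "?b \<noteq> 0" using b by simp
  obtain u v where right: "right_state (chart P x) = (u, v)" by (cases "right_state (chart P x)")
  \<comment> \<open>\<open>k\<close> and \<open>l\<close> are \<open>Utilde\<close> and
    \<open>V1\<close> at the right state, constant along the curve. The manifold equation gives
    \<open>Y = \<eta> z\<close>; \<open>h\<close> is the resulting speed, and
    \<open>\<gamma>\<close> takes \<open>t\<close> from \<open>chart_inverse\<close>.\<close>
  define k where "k = ?b * u + a\<^sub>1 P - a\<^sub>4 P"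
  define l where "l = v + a\<^sub>3 P"
  define m where "m z = (?b - 1) * z\<^sup>2 + 1" for z
  define \<eta> where "\<eta> z = 2 * (?c + (z\<^sup>2 - 1) * l - z * k) / m z" for z
  define h where "h z = u + a\<^sub>4 P + z * l + z * \<eta> z" for z
  define \<gamma> where "\<gamma> z = ((2 * z * (l + \<eta> z / 2) - (k + ?b * z * \<eta> z / 2)) / (?c * (z\<^sup>2 + 1)), z, \<eta> z)"
    for z
  let ?S = "chart P -` hugoniot' P (chart P x)"
  have m: "m z > 0" for z
    unfolding m_def using b by (intro add_nonneg_pos mult_nonneg_nonneg) auto
  then have m0: "m z \<noteq> 0" for z by (metis less_irrefl)
  have \<eta>_iff: "Y = \<eta> z \<longleftrightarrow> (z\<^sup>2 - 1) * (l + Y / 2) - z * (k + ?b * z * Y / 2) + ?c = 0" for Y z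
  proof -
    have "Y = \<eta> z \<longleftrightarrow> Y * m z = 2 * (?c + (z\<^sup>2 - 1) * l - z * k)"
      using m0[of z] by (simp add: \<eta>_def field_simps)
    also have "\<dots> \<longleftrightarrow> (z\<^sup>2 - 1) * (l + Y / 2) - z * (k + ?b * z * Y / 2) + ?c = 0"
      by (auto simp: m_def field_simps power2_eq_square)
    finally show ?thesis .
  qed
  have on_S: "Y = \<eta> z \<and> speed P (chart P (t, z, Y)) = h z" if "(t, z, Y) \<in> ?S" for t z Y
  proof -
    let ?q = "chart P (t, z, Y)"
    have "?q \<in> wave_manifold P" and r: "right_state ?q = (u, v)"
      using that right by (auto simp: hugoniot'_def)
    then have E: "(z\<^sup>2 - 1) * V1 P ?q - z * Utilde P ?q + ?c = 0"
      by (simp add: wave_manifold_def chart_simps)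
    have U: "Upt ?q = u + z * Y / 2" and V: "Vpt ?q = v + Y / 2"
      using r by (auto simp: right_state_def chart_simps(3,4))
    have UV: "Utilde P ?q = k + ?b * z * Y / 2" "V1 P ?q = l + Y / 2"
      by (simp_all add: Utilde_def V1_def U V k_def l_def algebra_simps)
    have Y: "Y = \<eta> z" using E unfolding \<eta>_iff UV .
    have "speed P ?q = u + z * Y / 2 + a\<^sub>4 P + z * (l + Y / 2)"
      by (simp add: speed_def chart_simps(5) U UV)
    then show ?thesis using Y by (simp add: h_def algebra_simps)
  qed
  have \<gamma>_S: "\<gamma> z \<in> ?S" for z
  proof -
    define q where "q = WPoint (u + z * \<eta> z / 2) (v + \<eta> z / 2) (z * \<eta> z) (\<eta> z) (Fin z)"
    have UV: "Utilde P q = k + ?b * z * \<eta> z / 2" "V1 P q = l + \<eta> z / 2"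
      by (simp_all add: q_def Utilde_def V1_def k_def l_def algebra_simps)
    have "q \<in> wave_manifold P"
      using \<eta>_iff[of "\<eta> z" z] UV by (simp add: wave_manifold_def q_def)
    moreover from this have "chart P (\<gamma> z) = q"
      using chart_inverse[OF b0 c, of q z] unfolding UV by (simp add: q_def \<gamma>_def)
    moreover have "right_state q = (u, v)"
      by (simp add: q_def right_state_def)
    ultimately show ?thesis using right by (simp add: hugoniot'_def)
  qed
  have x_S: "x \<in> ?S"
    using chart_in_wave_manifold[OF b0] by (simp add: hugoniot'_def)
  then have Y\<^sub>0: "Y\<^sub>0 = \<eta> z\<^sub>0" using on_S[of t\<^sub>0 z\<^sub>0 Y\<^sub>0] by (simp add: x)
  have kl: "k = 2 * ?c * z\<^sub>0 / (z\<^sub>0\<^sup>2 + 1) + ?c * t\<^sub>0 * (z\<^sub>0\<^sup>2 - 1) - ?b * z\<^sub>0 * Y\<^sub>0 / 2"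
    "l = ?c / (z\<^sub>0\<^sup>2 + 1) + ?c * t\<^sub>0 * z\<^sub>0 - Y\<^sub>0 / 2"
  proof -
    have u: "u = Upt (chart P x) - z\<^sub>0 * Y\<^sub>0 / 2" and v: "v = Vpt (chart P x) - Y\<^sub>0 / 2"
      using right by (auto simp: right_state_def chart_simps(3,4) x)
    show "k = 2 * ?c * z\<^sub>0 / (z\<^sub>0\<^sup>2 + 1) + ?c * t\<^sub>0 * (z\<^sub>0\<^sup>2 - 1) - ?b * z\<^sub>0 * Y\<^sub>0 / 2"
      using Utilde_chart[OF b0, of t\<^sub>0 z\<^sub>0 Y\<^sub>0] by (simp add: Utilde_def x k_def u right_diff_distrib)
    show "l = ?c / (z\<^sub>0\<^sup>2 + 1) + ?c * t\<^sub>0 * z\<^sub>0 - Y\<^sub>0 / 2"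
      using V1_chart[of P t\<^sub>0 z\<^sub>0 Y\<^sub>0] by (simp add: V1_def x l_def v)
  qed
  have "(2 * z\<^sub>0 * (l + Y\<^sub>0 / 2) - (k + ?b * z\<^sub>0 * Y\<^sub>0 / 2)) / (?c * (z\<^sub>0\<^sup>2 + 1)) = t\<^sub>0"
  proof -
    have "2 * z\<^sub>0 * (l + Y\<^sub>0 / 2) - (k + ?b * z\<^sub>0 * Y\<^sub>0 / 2) = t\<^sub>0 * (?c * (z\<^sub>0\<^sup>2 + 1))"
      unfolding kl by (simp add: power2_eq_square algebra_simps)
    then show ?thesis using c by simp
  qed
  then have \<gamma>_x: "\<gamma> z\<^sub>0 = x" by (simp add: \<gamma>_def x flip: Y\<^sub>0)
  have "(h has_real_derivative l + \<eta> z + z * (2 * (2 * z * l - k) - 2 * (?b - 1) * z * \<eta> z) / m z) (at z)"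
    for z
  proof -
    let ?n = "\<lambda>z. 2 * (?c + (z\<^sup>2 - 1) * l - z * k)"
    have m': "(m has_real_derivative 2 * (?b - 1) * z) (at z)"
      unfolding m_def by (auto intro!: derivative_eq_intros)
    have "(?n has_real_derivative 2 * (2 * z * l - k)) (at z)"
      by (auto intro!: derivative_eq_intros)
    from DERIV_divide[OF this m' m0]
    have "(\<eta> has_real_derivative (2 * (2 * z * l - k) * m z - ?n z * (2 * (?b - 1) * z)) / (m z * m z)) (at z)"
      unfolding \<eta>_def .
    also have "?n z = \<eta> z * m z" using m0[of z] by (simp add: \<eta>_def)
    also have "(2 * (2 * z * l - k) * m z - \<eta> z * m z * (2 * (?b - 1) * z)) / (m z * m z)
        = (2 * (2 * z * l - k) - 2 * (?b - 1) * z * \<eta> z) / m z"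
      using m0[of z] by (simp add: divide_simps) (simp add: algebra_simps)
    finally have "(\<eta> has_real_derivative (2 * (2 * z * l - k) - 2 * (?b - 1) * z * \<eta> z) / m z) (at z)" .
    then show ?thesis
      unfolding h_def by (auto intro!: derivative_eq_intros)
  qed
  moreover have "l + \<eta> z\<^sub>0 + z\<^sub>0 * (2 * (2 * z\<^sub>0 * l - k) - 2 * (?b - 1) * z\<^sub>0 * \<eta> z\<^sub>0) / m z\<^sub>0
      = - sonic_poly ?b ?c x / (2 * (z\<^sub>0\<^sup>2 + 1) * m z\<^sub>0)"
  proof -
    define \<kappa> where "\<kappa> = ?c / (z\<^sub>0\<^sup>2 + 1)"
    have c\<kappa>: "?c = \<kappa> * (z\<^sub>0\<^sup>2 + 1)" by (simp add: \<kappa>_def)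
    have k: "k = 2 * \<kappa> * z\<^sub>0 + ?c * t\<^sub>0 * (z\<^sub>0\<^sup>2 - 1) - ?b * z\<^sub>0 * Y\<^sub>0 / 2"
      and l: "l = \<kappa> + ?c * t\<^sub>0 * z\<^sub>0 - Y\<^sub>0 / 2"
      by (simp_all add: kl \<kappa>_def)
    have "2 * (z\<^sub>0\<^sup>2 + 1) * ((l + Y\<^sub>0) * m z\<^sub>0 + z\<^sub>0 * (2 * (2 * z\<^sub>0 * l - k) - 2 * (?b - 1) * z\<^sub>0 * Y\<^sub>0))
        = - sonic_poly ?b ?c x"
      unfolding sonic_poly_def x prod.case k l m_def c\<kappa>
      by (simp add: power2_eq_square algebra_simps add_divide_distrib diff_divide_distrib)
    moreover have "2 * (z\<^sub>0\<^sup>2 + 1) \<noteq> 0" by (simp del: distrib_left_numeral)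
    ultimately have "- sonic_poly ?b ?c x / (2 * (z\<^sub>0\<^sup>2 + 1) * m z\<^sub>0)
        = ((l + Y\<^sub>0) * m z\<^sub>0 + z\<^sub>0 * (2 * (2 * z\<^sub>0 * l - k) - 2 * (?b - 1) * z\<^sub>0 * Y\<^sub>0)) / m z\<^sub>0"
      by (metis mult_divide_mult_cancel_left)
    then show ?thesis
      using m0[of z\<^sub>0] by (simp flip: Y\<^sub>0 add: add_divide_distrib)
  qed
  moreover define C where "C = - sonic_poly ?b ?c x / (2 * (z\<^sub>0\<^sup>2 + 1) * m z\<^sub>0)"
  ultimately have h: "(h has_derivative (*) C) (at z\<^sub>0)"
    by (metis has_field_derivative_def)
  define s where "s y = speed P (chart P y)" for y
  define s' where "s' = frechet_derivative s (at x)"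
  have s: "(s has_derivative s') (at x)"
    using speed_chart_differentiable[OF b0] frechet_derivative_works unfolding s_def s'_def by blast
  have s_S: "s y = h (fst (snd y))" if "y \<in> ?S" for y
    using on_S[of "fst y" "fst (snd y)" "snd (snd y)"] that by (simp add: s_def)
  \<comment> \<open>The speed agrees with \<open>h\<close> only on the curve, so derivatives are
    compared along paths inside it.\<close>
  have s'_w: "s' w = C * fst (snd w)"
    if "w \<in> tangent_vectors ?S x" for w
  proof -
    obtain \<delta> where \<delta>: "\<delta> 0 = x" "\<And>y::real. \<delta> y \<in> ?S" "(\<delta> has_vector_derivative w) (at 0)"
      using \<open>w \<in> tangent_vectors ?S x\<close> unfolding tangent_vectors_def by blast
    have "((\<lambda>y. s (\<delta> y)) has_vector_derivative s' w) (at 0)"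
      by (rule has_vector_derivative_chain) (simp_all add: \<delta> s)
    then have 1: "((\<lambda>y. h (fst (snd (\<delta> y)))) has_vector_derivative s' w) (at 0)"
      by (simp add: s_S[OF \<delta>(2)])
    have "((\<lambda>y. fst (snd (\<delta> y))) has_vector_derivative fst (snd w)) (at 0)"
      by (rule has_vector_derivative_chain[where h = "\<lambda>y. fst (snd y)", OF _ \<delta>(3)])
        (auto intro!: derivative_eq_intros)
    moreover have "fst (snd (\<delta> 0)) = z\<^sub>0" by (simp add: \<delta>(1) x)
    ultimately have "((\<lambda>y. h (fst (snd (\<delta> y)))) has_vector_derivative C * fst (snd w)) (at 0)"
      using has_vector_derivative_chain[of h "(*) C" "\<lambda>y. fst (snd (\<delta> y))" 0] h by simp
    with 1 show ?thesis
      by (rule vector_derivative_unique_at)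
  qed
  \<comment> \<open>A velocity with \<open>z\<close> component 1, that of \<open>\<gamma>\<close>,
    makes criticality force \<open>C = 0\<close>.\<close>
  have "\<exists>w \<in> tangent_vectors ?S x. fst (snd w) = 1"
  proof -
    have "\<gamma> differentiable at z\<^sub>0"
      unfolding differentiable_def \<gamma>_def \<eta>_def m_def
      by (rule exI, (rule derivative_eq_intros refl | use m0[of z\<^sub>0] c in \<open>simp add: m_def\<close>)+)
    then have \<gamma>': "(\<gamma> has_vector_derivative vector_derivative \<gamma> (at z\<^sub>0)) (at z\<^sub>0)"
      by (rule vector_derivative_works[THEN iffD1])
    let ?w = "vector_derivative \<gamma> (at z\<^sub>0)"
    have "((\<lambda>y. z\<^sub>0 + y) has_vector_derivative 1) (at 0)"
      using has_vector_derivative_add[OF has_vector_derivative_const has_vector_derivative_id] by simp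
    then have "((\<lambda>y. \<gamma> (z\<^sub>0 + y)) has_vector_derivative ?w) (at 0)"
      using vector_diff_chain_at[of "\<lambda>y. z\<^sub>0 + y" 1 0 \<gamma> ?w] \<gamma>' by (simp add: comp_def)
    then have "?w \<in> tangent_vectors ?S x"
      unfolding tangent_vectors_def
      by (intro CollectI exI[of _ "\<lambda>y. \<gamma> (z\<^sub>0 + y)"] conjI allI \<gamma>_S) (simp_all add: \<gamma>_x)
    moreover have "((\<lambda>y. fst (snd (\<gamma> y))) has_vector_derivative fst (snd ?w)) (at z\<^sub>0)"
      by (rule has_vector_derivative_chain[where h = "\<lambda>y. fst (snd y)", OF _ \<gamma>'])
        (auto intro!: derivative_eq_intros)
    then have "((\<lambda>y. y) has_vector_derivative fst (snd ?w)) (at z\<^sub>0)"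
      by (simp add: \<gamma>_def)
    then have "fst (snd ?w) = 1"
      using vector_derivative_unique_at[OF _ has_vector_derivative_id] by blast
    ultimately show ?thesis by blast
  qed
  moreover have "x \<in> sonic' P \<longleftrightarrow> (\<forall>w\<in>tangent_vectors ?S x. s' w = 0)"
    using x_S unfolding sonic'_def critical_on_def s'_def s_def by simp
  ultimately have "x \<in> sonic' P \<longleftrightarrow> C = 0"
    using s'_w by auto
  then show "x \<in> sonic' P \<longleftrightarrow> x \<in> {x. sonic_poly ?b ?c x = 0}"
    using m0[of z\<^sub>0] square_plus_one_neq_0[of z\<^sub>0]
    by (simp add: C_def del: distrib_left_numeral)
qed

section \<open>Slow, fast and fold points through the sign of the gap\<close>

lemma slow_sonic'_eq:
  assumes "b\<^sub>1 P > 1" and "c_par P \<noteq> 0"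
  shows "slow_sonic' P =
    {x. sonic_poly (b\<^sub>1 P) (c_par P) x = 0 \<and> speed_gap (b\<^sub>1 P) (c_par P) x > 0}"
proof -
  have "(\<exists>q. is_slow_point P (chart P x) q \<and> speed P (chart P x) = speed P q)
      \<longleftrightarrow> speed_gap (b\<^sub>1 P) (c_par P) x > 0" if "sonic_poly (b\<^sub>1 P) (c_par P) x = 0" for x
    unfolding is_slow_point_def
    using bij_betw_pair_less_iff(1)[OF sonic_char_speeds[OF _ assms(2) that]] assms(1) by force
  then show ?thesis
    using assms by (auto simp: slow_sonic'_def sonic'_eq)
qed

lemma fast_sonic'_eq:
  assumes "b\<^sub>1 P > 1" and "c_par P \<noteq> 0"
  shows "fast_sonic' P =
    {x. sonic_poly (b\<^sub>1 P) (c_par P) x = 0 \<and> speed_gap (b\<^sub>1 P) (c_par P) x < 0}"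
proof -
  have "(\<exists>q. is_fast_point P (chart P x) q \<and> speed P (chart P x) = speed P q)
      \<longleftrightarrow> speed_gap (b\<^sub>1 P) (c_par P) x < 0" if "sonic_poly (b\<^sub>1 P) (c_par P) x = 0" for x
    unfolding is_fast_point_def
    using bij_betw_pair_less_iff(2)[OF sonic_char_speeds[OF _ assms(2) that]] assms(1) by force
  then show ?thesis
    using assms by (auto simp: fast_sonic'_def sonic'_eq)
qed

text \<open>By \<open>left_discriminant\<close> the discriminant defining \<open>fold_surface\<close> is a square minus a
  multiple of \<open>sonic_poly\<close>, with nonzero factor. So the two differentials are proportional
  wherever the two surfaces meet.\<close>

lemma sonic'_fold_eq:
  assumes b: "b\<^sub>1 P > 1" and c: "c_par P > 0"
  shows "sonic'_fold P =
    {x. sonic_poly (b\<^sub>1 P) (c_par P) x = 0 \<and> speed_gap (b\<^sub>1 P) (c_par P) x = 0}"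
proof -
  define N where "N = sonic_poly (b\<^sub>1 P) (c_par P)"
  define E where "E = speed_gap (b\<^sub>1 P) (c_par P)"
  define K :: "coords \<Rightarrow> real" where "K x = snd (snd x) / ((fst (snd x))\<^sup>2 + 1)" for x
  define D where "D x = (E x)\<^sup>2 - K x * N x" for x
  have sonic: "sonic' P = {x. N x = 0}"
    using b c by (simp add: sonic'_eq N_def)
  have fold: "fold_surface P = {x. D x = 0}"
    using b c by (auto simp: fold_surface_eq N_def E_def D_def K_def)
  have contK: "continuous_on UNIV K"
    unfolding K_def by (intro continuous_intros) simp
  have diffK: "K differentiable at x" for x
    unfolding K_def differentiable_def by (rule exI, (rule derivative_eq_intros refl | simp)+)
  have contD: "continuous_on UNIV D"
    unfolding D_def N_def E_def
    by (intro continuous_intros contK continuous_on_sonic_poly continuous_on_speed_gap)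
  have contN: "continuous_on UNIV N"
    unfolding N_def by (rule continuous_on_sonic_poly)
  have tangent: "tangent_vectors {x. N x = 0} x = tangent_vectors {x. D x = 0} x"
    if x0: "N x = 0" "E x = 0" for x
  proof -
    obtain t z Y where x: "x = (t, z, Y)" by (cases x)
    have K: "K x \<noteq> 0"
      using sonic_fold_Y_neq_0[of "b\<^sub>1 P" "c_par P" t z Y] b c x0 by (simp add: K_def N_def E_def x)
    obtain N' E' K' where der: "(N has_derivative N') (at x)" "(E has_derivative E') (at x)"
      "(K has_derivative K') (at x)"
      using differentiable_sonic_poly differentiable_speed_gap diffK
      unfolding N_def E_def differentiable_def by metis
    have "(D has_derivative (\<lambda>h. 2 * E' h * E x - (K x * N' h + K' h * N x))) (at x)"
      unfolding D_def by (rule derivative_eq_intros der refl | simp)+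
    then have derD: "(D has_derivative (\<lambda>h. - K x * N' h)) (at x)"
      by (simp add: x0)
    \<comment> \<open>\<open>- \<beta>\<close> and \<open>\<alpha>\<close> are the partial
      derivatives of \<open>N\<close> in \<open>t\<close> and \<open>Y\<close>. If
      \<open>\<beta> = 0\<close> then \<open>z = 0\<close> and \<open>\<alpha> = - 1\<close>, so
      \<open>N\<close> has nonzero derivative along \<open>(- \<beta>, 0, \<alpha>)\<close>.\<close>
    define \<alpha> where "\<alpha> = ((b\<^sub>1 P + 1) * z\<^sup>2 - 1) * (z\<^sup>2 + 1)"
    define \<beta> where "\<beta> = 2 * c_par P * (z * (z\<^sup>2 + 1) * ((b\<^sub>1 P + 1) * z\<^sup>2 + 3))"
    have "\<alpha> \<noteq> 0 \<or> \<beta> \<noteq> 0"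
    proof (cases "z = 0")
      case False
      have "(b\<^sub>1 P + 1) * z\<^sup>2 + 3 > 0"
        using b by (intro add_nonneg_pos mult_nonneg_nonneg) auto
      then show ?thesis using False c by (simp add: \<beta>_def)
    qed (simp add: \<alpha>_def)
    then have \<alpha>\<beta>: "\<alpha>\<^sup>2 + \<beta>\<^sup>2 \<noteq> 0" by (simp add: sum_power2_eq_zero_iff)
    have "((\<lambda>r. x + r *\<^sub>R w) has_vector_derivative w) (at 0)" for w :: coords
      unfolding has_vector_derivative_def by (auto intro!: derivative_eq_intros)
    then have "((\<lambda>r. N (x + r *\<^sub>R (- \<beta>, 0, \<alpha>))) has_vector_derivative N' (- \<beta>, 0, \<alpha>)) (at 0)"
      by (rule has_vector_derivative_chain[rotated]) (simp add: der flip: zero_prod_def)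
    moreover have "N (x + r *\<^sub>R (- \<beta>, 0, \<alpha>)) = r * (\<alpha>\<^sup>2 + \<beta>\<^sup>2)" for r
    proof -
      have "N (x + r *\<^sub>R (- \<beta>, 0, \<alpha>)) = N x + r * (\<alpha>\<^sup>2 + \<beta>\<^sup>2)"
        by (simp add: N_def sonic_poly_def x flip: \<alpha>_def)
          (simp add: \<alpha>_def \<beta>_def power2_eq_square algebra_simps)
      then show ?thesis by (simp add: x0)
    qed
    ultimately have "((\<lambda>r. r * (\<alpha>\<^sup>2 + \<beta>\<^sup>2)) has_vector_derivative N' (- \<beta>, 0, \<alpha>)) (at 0)"
      by simp
    moreover have "((\<lambda>r. r * (\<alpha>\<^sup>2 + \<beta>\<^sup>2)) has_vector_derivative \<alpha>\<^sup>2 + \<beta>\<^sup>2) (at 0)"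
      by (auto intro!: derivative_eq_intros)
    ultimately have "N' (- \<beta>, 0, \<alpha>) \<noteq> 0"
      using vector_derivative_unique_at \<alpha>\<beta> by metis
    then have "tangent_vectors {x. N x = 0} x = {w. N' w = 0}"
      "tangent_vectors {x. D x = 0} x = {w. - K x * N' w = 0}"
      using tangent_vectors_level_set[OF contN der(1)] tangent_vectors_level_set[OF contD derD]
        x0 K by (simp_all add: D_def)
    then show ?thesis using K by simp
  qed
  show ?thesis
    unfolding sonic'_fold_def sonic fold N_def[symmetric] E_def[symmetric]
    using tangent by (auto simp: D_def)
qed

lemma sonic'_line_eq:
  "sonic'_line P = {x. sonic_poly (b\<^sub>1 P) (c_par P) x = 0 \<and> fst (snd x) = 0}"
  by (auto simp: sonic'_line_def sonic_poly_def)

section \<open>Boundaries of the slow and fast regions\<close>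

text \<open>By \<open>gap_numerator_eq\<close>, off \<open>z = 0\<close> the gap has the sign of \<open>z * gap_numerator\<close>; the line
  \<open>z = 0\<close> projects to the single point \<open>(0, - 2 * c)\<close>.\<close>

lemma snd_image_gap_region:
  assumes b: "b > 1" and c: "c > 0" and "e \<noteq> 0"
  shows "snd ` {x. sonic_poly b c x = 0 \<and> e * speed_gap b c x > 0}
    = {p. e * (fst p * gap_numerator b c p) > 0} \<union> {(0, - 2 * c)}"
proof (intro equalityI subsetI)
  fix p assume "p \<in> snd ` {x. sonic_poly b c x = 0 \<and> e * speed_gap b c x > 0}"
  then obtain t z Y where p: "p = (z, Y)" and N: "sonic_poly b c (t, z, Y) = 0"
    and E: "e * speed_gap b c (t, z, Y) > 0" by auto
  show "p \<in> {p. e * (fst p * gap_numerator b c p) > 0} \<union> {(0, - 2 * c)}"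
  proof (cases "z = 0")
    case True
    then show ?thesis using N by (simp add: sonic_poly_def p)
  next
    case False
    have "(b + 1) * z\<^sup>2 + 3 > 0" using b by (intro add_nonneg_pos mult_nonneg_nonneg) auto
    then have "0 < (2 * z\<^sup>2 * ((b + 1) * z\<^sup>2 + 3)) * (e * speed_gap b c (t, z, Y))"
      using False E by simp
    also have "\<dots> = e * z * (2 * z * ((b + 1) * z\<^sup>2 + 3) * speed_gap b c (t, z, Y))"
      by (simp add: power2_eq_square mult_ac)
    also have "\<dots> = e * (z * gap_numerator b c (z, Y))"
      unfolding gap_numerator_eq N by simp
    finally show ?thesis by (simp add: p)
  qed
next
  fix p assume p: "p \<in> {p. e * (fst p * gap_numerator b c p) > 0} \<union> {(0, - 2 * c)}"
  obtain z Y where zY: "p = (z, Y)" by (cases p)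
  have "\<exists>t. sonic_poly b c (t, z, Y) = 0 \<and> e * speed_gap b c (t, z, Y) > 0"
  proof (cases "z = 0")
    case True
    have "Y = - 2 * c" using p True by (simp add: zY)
    \<comment> \<open>On the line \<open>t\<close> is free and the gap is \<open>- c * t\<close>, so
      \<open>t = - e\<close> gives it the sign of \<open>e\<close>.\<close>
    then have "sonic_poly b c (- e, z, Y) = 0" and "e * speed_gap b c (- e, z, Y) = c * e\<^sup>2"
      using True by (simp_all add: sonic_poly_def speed_gap_def power2_eq_square)
    moreover have "c * e\<^sup>2 > 0" using c assms(3) by simp
    ultimately show ?thesis by metis
  next
    case False
    have pos: "(b + 1) * z\<^sup>2 + 3 > 0" using b by (intro add_nonneg_pos mult_nonneg_nonneg) auto
    define a where "a = 2 * c * (z * (z\<^sup>2 + 1) * ((b + 1) * z\<^sup>2 + 3))"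
    define t where "t = (((b + 1) * z\<^sup>2 - 1) * (z\<^sup>2 + 1) * Y - 2 * c * ((b - 1) * z\<^sup>2 + 1)) / a"
    have "a \<noteq> 0" using False pos c by (simp add: a_def)
    then have "a * t = ((b + 1) * z\<^sup>2 - 1) * (z\<^sup>2 + 1) * Y - 2 * c * ((b - 1) * z\<^sup>2 + 1)"
      by (simp add: t_def)
    then have N: "sonic_poly b c (t, z, Y) = 0" by (simp add: sonic_poly_def a_def)
    have "0 < e * (z * gap_numerator b c (z, Y))"
      using p False by (simp add: zY)
    also have "\<dots> = e * z * (2 * z * ((b + 1) * z\<^sup>2 + 3) * speed_gap b c (t, z, Y))"
      unfolding gap_numerator_eq N by simp
    also have "\<dots> = (2 * z\<^sup>2 * ((b + 1) * z\<^sup>2 + 3)) * (e * speed_gap b c (t, z, Y))"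
      by (simp add: power2_eq_square mult_ac)
    finally have "e * speed_gap b c (t, z, Y) > 0"
      by (rule zero_less_mult_pos) (use False pos in simp)
    with N show ?thesis by blast
  qed
  then show "p \<in> snd ` {x. sonic_poly b c x = 0 \<and> e * speed_gap b c x > 0}"
    by (force simp: zY)
qed

text \<open>The curves \<open>z = 0\<close> and \<open>gap_numerator = 0\<close> cross at
  \<open>(0, - 2 * c)\<close>. Elsewhere on them a step across the one curve, directed by
  \<open>e\<close> and the other factor, gives the product the sign of \<open>e\<close>. At the
  crossing a line of slope \<open>e\<close> does so.\<close>

lemma gap_numerator_zero_in_closure:
  assumes b: "b > 1" and c: "c > 0" and e: "e \<noteq> 0" and p0: "fst p * gap_numerator b c p = 0"
  shows "p \<in> closure {p. e * (fst p * gap_numerator b c p) > 0}" (is "_ \<in> closure ?S")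
proof -
  obtain z Y where p: "p = (z, Y)" by (cases p)
  consider "z \<noteq> 0" "gap_numerator b c (z, Y) = 0" | "z = 0" "Y \<noteq> - 2 * c" | "z = 0" "Y = - 2 * c"
    using p0 by (auto simp: p)
  then show ?thesis
  proof cases
    case 1
    show ?thesis
    proof (rule in_closure_at_right[where \<gamma> = "\<lambda>x. (z, Y + x * (e * z))"])
      have "gap_numerator b c (z, Y + x * (e * z)) = x * e * z * fold_quartic b z" for x
        using 1(2) by (simp add: gap_numerator_def algebra_simps)
      then have eq: "e * (z * gap_numerator b c (z, Y + x * (e * z))) = x * (e * z)\<^sup>2 * fold_quartic b z" for x
        by (simp add: power2_eq_square)
      show "eventually (\<lambda>x. (z, Y + x * (e * z)) \<in> ?S) (at_right 0)"
        using fold_quartic_pos[OF b, of z] 1 e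
        by (auto intro!: eventually_at_right_less[THEN eventually_mono] simp: eq)
    qed (auto simp: p intro!: continuous_intros)
  next
    case 2
    define g where "g = Y + 2 * c"
    have g: "g \<noteq> 0" using 2 by (simp add: g_def)
    define G where "G x = g * gap_numerator b c (x * (e * g), Y)" for x
    have "isCont G 0"
      unfolding G_def gap_numerator_def fold_quartic_def prod.case by (intro continuous_intros)
    moreover have "G 0 > 0"
      using g by (simp add: G_def gap_numerator_def fold_quartic_def g_def flip: power2_eq_square)
    ultimately have "eventually (\<lambda>x. G x > 0) (at_right 0)"
      by (rule eventually_at_right_pos)
    show ?thesis
    proof (rule in_closure_at_right[where \<gamma> = "\<lambda>x. (x * (e * g), Y)"])
      have eq: "e * (x * (e * g) * gap_numerator b c (x * (e * g), Y)) = x * e\<^sup>2 * G x" for x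
        by (simp add: G_def power2_eq_square mult_ac)
      show "eventually (\<lambda>x. (x * (e * g), Y) \<in> ?S) (at_right 0)"
        using \<open>eventually (\<lambda>x. G x > 0) (at_right 0)\<close> eventually_at_right_less[of 0]
        by eventually_elim (use e in \<open>simp add: eq\<close>)
    qed (auto simp: p 2 intro!: continuous_intros)
  next
    case 3
    \<comment> \<open>\<open>R\<close> is \<open>gap_numerator\<close> on the line of slope
      \<open>e\<close>, divided by \<open>x\<close>; its value at 0 is \<open>e\<close>.\<close>
    define R where "R x = fold_quartic b x * e + 2 * c * x * ((b - 1) - ((b + 1)\<^sup>2 * x\<^sup>2 + 2 * (b + 3)))" for x
    have R: "gap_numerator b c (x, - 2 * c + x * e) = x * R x" for x
      by (simp add: gap_numerator_def R_def fold_quartic_def algebra_simps power2_eq_square power4_eq_xxxx)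
    define G where "G x = e * R x" for x
    have "isCont G 0"
      unfolding G_def R_def fold_quartic_def by (intro continuous_intros)
    moreover have "G 0 > 0"
      using e by (simp add: G_def R_def fold_quartic_def flip: power2_eq_square)
    ultimately have "eventually (\<lambda>x. G x > 0) (at_right 0)"
      by (rule eventually_at_right_pos)
    show ?thesis
    proof (rule in_closure_at_right[where \<gamma> = "\<lambda>x. (x, - 2 * c + x * e)"])
      have eq: "e * (x * gap_numerator b c (x, - 2 * c + x * e)) = x\<^sup>2 * G x" for x
        unfolding R by (simp add: G_def power2_eq_square mult_ac)
      show "eventually (\<lambda>x. (x, - 2 * c + x * e) \<in> ?S) (at_right 0)"
        using \<open>eventually (\<lambda>x. G x > 0) (at_right 0)\<close> eventually_at_right_less[of 0]
        by eventually_elim (simp only: mem_Collect_eq fst_conv eq, simp)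
    qed (auto simp: p 3 intro!: continuous_intros)
  qed
qed

lemma continuous_on_gap_numerator: "continuous_on S (gap_numerator b c)"
  unfolding gap_numerator_def fold_quartic_def case_prod_beta by (intro continuous_intros)

text \<open>The extra point \<open>(0, - 2 * c)\<close> is a zero of the product, hence on the
  frontier anyway. The closure lemma at \<open>- e\<close> supplies the other side.\<close>

lemma frontier_snd_image_gap_region:
  assumes b: "b > 1" and c: "c > 0" and e: "e \<noteq> 0"
  shows "frontier (snd ` {x. sonic_poly b c x = 0 \<and> e * speed_gap b c x > 0})
    = {p. fst p * gap_numerator b c p = 0}"
proof -
  let ?h = "\<lambda>p. e * (fst p * gap_numerator b c p)"
  have "continuous_on UNIV ?h"
    by (intro continuous_intros continuous_on_gap_numerator)
  moreover have "{(0, - 2 * c)} \<subseteq> {p \<in> topspace euclidean. ?h p = 0}" by simp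
  ultimately have "euclidean frontier_of ({p \<in> topspace euclidean. ?h p > 0} \<union> {(0, - 2 * c)})
      = {p \<in> topspace euclidean. ?h p = 0}"
    using gap_numerator_zero_in_closure[OF b c e] gap_numerator_zero_in_closure[OF b c, of "- e"] e
    by (intro frontier_of_positive_region) (auto simp: continuous_map_iff_continuous2)
  then show ?thesis
    using e by (simp add: snd_image_gap_region[OF b c e])
qed

lemma zY_boundary_gap_region:
  assumes b: "b\<^sub>1 P > 1" and c: "c_par P > 0" and e: "e \<noteq> 0"
  shows "zY_boundary (sonic' P)
      {x. sonic_poly (b\<^sub>1 P) (c_par P) x = 0 \<and> e * speed_gap (b\<^sub>1 P) (c_par P) x > 0}
    = sonic'_fold P \<union> sonic'_line P"
proof -
  have "fst (snd x) * gap_numerator (b\<^sub>1 P) (c_par P) (snd x) = 0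
      \<longleftrightarrow> speed_gap (b\<^sub>1 P) (c_par P) x = 0 \<or> fst (snd x) = 0"
    if "sonic_poly (b\<^sub>1 P) (c_par P) x = 0" for x
  proof -
    obtain t z Y where x: "x = (t, z, Y)" by (cases x)
    have "(b\<^sub>1 P + 1) * z\<^sup>2 + 3 > 0" using b by (intro add_nonneg_pos mult_nonneg_nonneg) auto
    then show ?thesis
      using gap_numerator_eq[of z "b\<^sub>1 P" "c_par P" t Y] that by (auto simp: x)
  qed
  then show ?thesis
    using b c unfolding zY_boundary_def frontier_snd_image_gap_region[OF b c e]
    by (auto simp: sonic'_fold_eq sonic'_line_eq sonic'_eq)
qed

section \<open>Frontiers in the subspace topology of \<open>sonic'\<close>\<close>

lemma speed_gap_zero_in_closure:
  assumes b: "b > 1" and c: "c > 0" and e: "e \<noteq> 0"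
    and x0: "sonic_poly b c x = 0" "speed_gap b c x = 0"
  shows "x \<in> closure {x. sonic_poly b c x = 0 \<and> e * speed_gap b c x > 0}"
proof -
  obtain t z Y where x: "x = (t, z, Y)" by (cases x)
  \<comment> \<open>This path stays in \<open>sonic'\<close> by \<open>sonic_poly_line\<close>, and
    by \<open>speed_gap_line\<close> with \<open>k = e\<close> its gap leaves 0 with the sign of
    \<open>e\<close>.\<close>
  let ?\<gamma> = "\<lambda>r. (t + r * (((b + 1) * z\<^sup>2 - 1) * (z\<^sup>2 + 1) * e), z,
       Y + r * (2 * c * (z * (z\<^sup>2 + 1) * ((b + 1) * z\<^sup>2 + 3)) * e))"
  show ?thesis
  proof (rule in_closure_at_right[where \<gamma> = ?\<gamma>])
    have "e * speed_gap b c (?\<gamma> r) = r * (e\<^sup>2 * c * (z\<^sup>2 + 1) * fold_quartic b z)" for r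
      unfolding speed_gap_line using x0 by (simp add: x power2_eq_square)
    moreover have "e\<^sup>2 * c * (z\<^sup>2 + 1) * fold_quartic b z > 0"
      using fold_quartic_pos[OF b] c e by (intro mult_pos_pos add_nonneg_pos) auto
    ultimately show "eventually (\<lambda>r. ?\<gamma> r \<in> {x. sonic_poly b c x = 0 \<and> e * speed_gap b c x > 0}) (at_right 0)"
      using x0 unfolding sonic_poly_line mem_Collect_eq
      by (auto intro!: eventually_at_right_less[THEN eventually_mono] simp: x)
  qed (auto simp: x intro!: continuous_intros)
qed

text \<open>The gap is continuous on \<open>sonic'\<close> and vanishes exactly on the fold. The
  line \<open>z = 0\<close> becomes boundary only through the projection, which collapses
  it.\<close>

lemma frontier_of_gap_region:
  assumes b: "b\<^sub>1 P > 1" and c: "c_par P > 0" and e: "e \<noteq> 0"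
  shows "top_of_set (sonic' P) frontier_of
      {x. sonic_poly (b\<^sub>1 P) (c_par P) x = 0 \<and> e * speed_gap (b\<^sub>1 P) (c_par P) x > 0} = sonic'_fold P"
proof -
  let ?N = "sonic_poly (b\<^sub>1 P) (c_par P)" and ?E = "speed_gap (b\<^sub>1 P) (c_par P)"
  have sonic: "sonic' P = {x. ?N x = 0}" using b c by (simp add: sonic'_eq)
  have closure: "x \<in> top_of_set {x. ?N x = 0} closure_of {x. ?N x = 0 \<and> k * ?E x > 0}"
    if "?N x = 0" "?E x = 0" "k \<noteq> 0" for x k
    using speed_gap_zero_in_closure[OF b c that(3,1,2)] that
    by (simp add: closure_of_subtopology Int_def conj_commute)
  have "top_of_set {x. ?N x = 0} frontier_of
      ({x \<in> topspace (top_of_set {x. ?N x = 0}). e * ?E x > 0} \<union> {})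
      = {x \<in> topspace (top_of_set {x. ?N x = 0}). e * ?E x = 0}"
  proof (rule frontier_of_positive_region)
    show "continuous_map (top_of_set {x. ?N x = 0}) euclideanreal (\<lambda>x. e * ?E x)"
      by (simp, intro continuous_intros continuous_on_speed_gap)
    show "x \<in> top_of_set {x. ?N x = 0} closure_of {x \<in> topspace (top_of_set {x. ?N x = 0}). e * ?E x > 0}"
      "x \<in> top_of_set {x. ?N x = 0} closure_of {x \<in> topspace (top_of_set {x. ?N x = 0}). e * ?E x < 0}"
      if "x \<in> topspace (top_of_set {x. ?N x = 0})" "e * ?E x = 0" for x
      using closure[of x e] closure[of x "- e"] that e by simp_all
  qed simp
  then show ?thesis
    using b c e by (simp add: sonic sonic'_fold_eq)
qed

theorem proposition2:
  fixes P :: flux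
  assumes "b\<^sub>1 P > 1" and "c_par P > 0"
  shows "zY_boundary (sonic' P) (slow_sonic' P) = sonic'_fold P \<union> sonic'_line P
    \<and> zY_boundary (sonic' P) (fast_sonic' P) = sonic'_fold P \<union> sonic'_line P
    \<and> (\<forall>K\<in>components (sonic' P - (sonic'_fold P \<union> sonic'_line P)).
         K \<subseteq> slow_sonic' P \<or> K \<subseteq> fast_sonic' P)
    \<and> top_of_set (sonic' P) frontier_of slow_sonic' P = sonic'_fold P
    \<and> top_of_set (sonic' P) frontier_of fast_sonic' P = sonic'_fold P"
proof -
  let ?N = "sonic_poly (b\<^sub>1 P) (c_par P)" and ?E = "speed_gap (b\<^sub>1 P) (c_par P)"
  \<comment> \<open>The factors \<open>1\<close> and \<open>- 1\<close> are the two choices of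
    \<open>e\<close> in the lemmas above.\<close>
  have slow: "slow_sonic' P = {x. ?N x = 0 \<and> 1 * ?E x > 0}"
    and fast: "fast_sonic' P = {x. ?N x = 0 \<and> - 1 * ?E x > 0}"
    using assms by (simp_all add: slow_sonic'_eq fast_sonic'_eq)
  have "K \<subseteq> slow_sonic' P \<or> K \<subseteq> fast_sonic' P"
    if K: "K \<in> components (sonic' P - (sonic'_fold P \<union> sonic'_line P))" for K
  proof -
    have sub: "K \<subseteq> {x. ?N x = 0 \<and> ?E x \<noteq> 0}"
      using in_components_subset[OF K] assms by (auto simp: sonic'_eq sonic'_fold_eq)
    \<comment> \<open>The image of \<open>K\<close> under the gap is connected and misses 0, so the
      gap keeps one sign.\<close>
    have "connected (?E ` K)"
      using in_components_connected[OF K] continuous_on_speed_gap by (rule connected_continuous_image[rotated])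
    moreover have nonzero: "?E x \<noteq> 0" if "x \<in> K" for x using sub that by auto
    then have "0 \<notin> ?E ` K" by force
    ultimately have "\<not> (?E x < 0 \<and> 0 < ?E y)" if "x \<in> K" "y \<in> K" for x y
      using connectedD_interval[of "?E ` K" "?E x" "?E y" 0] that by auto
    then have "(\<forall>x\<in>K. ?E x > 0) \<or> (\<forall>x\<in>K. ?E x < 0)"
      using nonzero by (meson linorder_neqE_linordered_idom)
    then show ?thesis
      using sub by (auto simp: slow fast)
  qed
  moreover have "(- 1 :: real) \<noteq> 0" by simp
  note zY_boundary_gap_region[OF assms this] frontier_of_gap_region[OF assms this]
  ultimately show ?thesis
    using zY_boundary_gap_region[OF assms one_neq_zero] frontier_of_gap_region[OF assms one_neq_zero]
    unfolding slow fast by blast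
qed

end
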